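(* Let $\mathcal{M}_1,\ldots,\mathcal{M}_k$ be graph matroid families and let $\mathcal{M}$ be their union. If each of $\mathcal{M}_1,\ldots,\mathcal{M}_k$ has the Lovász-Yemini property, then so does $\mathcal{M}$.
   Context: All graphs are finite and simple and have no isolated vertices. A graph matroid family $\mathcal{M}$ assigns to every graph $G$ a matroid $\mathcal{M}(G)$ on $E(G)$ such that (i) every graph isomorphism $V(G)\to V(H)$ induces an isomorphism $\mathcal{M}(G)\to\mathcal{M}(H)$, and (ii) for every subgraph $H$ of $G$, $\mathcal{M}(H)$ is the restriction of $\mathcal{M}(G)$ to $E(H)$. The union $\mathcal{M}$ of $\mathcal{M}_1,\dots,\mathcal{M}_k$ is given by $\mathcal{M}(G)=\bigcup_i\mathcal{M}_i(G)$ (matroid union). A graph $G$ is $\mathcal{M}$-rigid if the rank of $\mathcal{M}(G)$ equals the rank of $\mathcal{M}(K_{V(G)})$, where $K_V$ denotes the complete graph on $V$. $\mathcal{M}$ has the Lovász-Yemini property if there is a nonnegative integer $c$ such that every $c$-connected graph is $\mathcal{M}$-rigid. *)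

theory Defs
  imports Main
begin

text \<open>A finite simple graph without isolated vertices is represented by its edge set:
  a finite set of 2-element vertex sets. Its vertex set is the union of its edges.\<close>

type_synonym 'a graph = "'a set set"

definition is_graph :: "'a graph \<Rightarrow> bool" where
  "is_graph E \<longleftrightarrow> finite E \<and> (\<forall>e\<in>E. card e = 2)"

definition verts :: "'a graph \<Rightarrow> 'a set" where
  "verts E = \<Union>E"

definition complete_graph :: "'a set \<Rightarrow> 'a graph" where
  "complete_graph V = {{u, v} | u v. u \<in> V \<and> v \<in> V \<and> u \<noteq> v}"

text \<open>Matroids on a finite ground set, given by their independence predicate.\<close>

definition matroid :: "'b set \<Rightarrow> ('b set \<Rightarrow> bool) \<Rightarrow> bool" where
  "matroid E indep \<longleftrightarrow> finite E \<and>
     (\<forall>X. indep X \<longrightarrow> X \<subseteq> E) \<and>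
     indep {} \<and>
     (\<forall>X Y. indep X \<and> Y \<subseteq> X \<longrightarrow> indep Y) \<and>
     (\<forall>X Y. indep X \<and> indep Y \<and> card X < card Y \<longrightarrow>
        (\<exists>y\<in>Y - X. indep (insert y X)))"

definition mrank :: "'b set \<Rightarrow> ('b set \<Rightarrow> bool) \<Rightarrow> nat" where
  "mrank E indep = Max (card ` {X. X \<subseteq> E \<and> indep X})"

text \<open>A graph matroid family assigns to every graph G a matroid (independence predicate)
  on E(G).\<close>

type_synonym 'a gmfam = "'a graph \<Rightarrow> ('a set set \<Rightarrow> bool)"

definition graph_iso :: "('a \<Rightarrow> 'a) \<Rightarrow> 'a graph \<Rightarrow> 'a graph \<Rightarrow> bool" where
  "graph_iso f G H \<longleftrightarrow> bij_betw f (verts G) (verts H) \<and>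
     (\<forall>u\<in>verts G. \<forall>v\<in>verts G. {u, v} \<in> G \<longleftrightarrow> {f u, f v} \<in> H)"

definition graph_matroid_family :: "'a gmfam \<Rightarrow> bool" where
  "graph_matroid_family M \<longleftrightarrow>
     (\<forall>G. is_graph G \<longrightarrow> matroid G (M G)) \<and>
     (\<forall>G H f. is_graph G \<and> is_graph H \<and> graph_iso f G H \<longrightarrow>
        (\<forall>X. X \<subseteq> G \<longrightarrow> (M G X \<longleftrightarrow> M H ((\<lambda>e. f ` e) ` X)))) \<and>
     (\<forall>G H. is_graph G \<and> H \<subseteq> G \<longrightarrow>
        (\<forall>X. M H X \<longleftrightarrow> X \<subseteq> H \<and> M G X))"

text \<open>Matroid union of the families Ms 0, ..., Ms (k-1).\<close>

definition union_family :: "(nat \<Rightarrow> 'a gmfam) \<Rightarrow> nat \<Rightarrow> 'a gmfam" where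
  "union_family Ms k G = (\<lambda>X. \<exists>Xs. (\<forall>i<k. Ms i G (Xs i)) \<and> X = (\<Union>i<k. Xs i))"

definition rigid :: "'a gmfam \<Rightarrow> 'a graph \<Rightarrow> bool" where
  "rigid M G \<longleftrightarrow>
     mrank G (M G) = mrank (complete_graph (verts G)) (M (complete_graph (verts G)))"

text \<open>Connectivity. c-connected: more than c vertices, and deleting fewer than c
  vertices leaves a connected graph.\<close>

definition adj :: "'a graph \<Rightarrow> ('a \<times> 'a) set" where
  "adj F = {(u, v). {u, v} \<in> F \<and> u \<noteq> v}"

definition connected_on :: "'a set \<Rightarrow> 'a graph \<Rightarrow> bool" where
  "connected_on W F \<longleftrightarrow> (\<forall>u\<in>W. \<forall>v\<in>W. (u, v) \<in> (adj F \<inter> W \<times> W)\<^sup>*)"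

definition k_connected :: "nat \<Rightarrow> 'a graph \<Rightarrow> bool" where
  "k_connected c G \<longleftrightarrow> card (verts G) > c \<and>
     (\<forall>S. S \<subseteq> verts G \<and> card S < c \<longrightarrow>
        connected_on (verts G - S) {e \<in> G. e \<inter> S = {}})"

definition lovasz_yemini :: "'a gmfam \<Rightarrow> bool" where
  "lovasz_yemini M \<longleftrightarrow> (\<exists>c::nat. \<forall>G. is_graph G \<and> k_connected c G \<longrightarrow> rigid M G)"

end

theory Submission
  imports Defs "HOL-Combinatorics.Permutations"
begin

text \<open>
  A family with the Lovasz-Yemini property has a slope \<open>D\<close>: for large \<open>n\<close>, passing from \<open>K_n\<close> to
  \<open>K_{n+1}\<close> raises the rank by exactly \<open>D\<close>, and by symmetry attaching a new vertex by \<open>D\<close> edges to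
  any graph raises the rank by at least \<open>D\<close>. The union inherits this with the sum of the slopes, and
  large complete bipartite graphs are rigid in the union because they contain edge-disjoint highly
  connected spanning subgraphs, one for each member.

  These two facts already give the property for the union, by an averaging argument over
  vertex orderings due to Villanyi. In a closed graph, a vertex attached to a large set that is
  not a clique raises the rank by at least \<open>D + 1\<close>. In a minimal closed counterexample no
  neighbourhood is a clique, as such a vertex could be deleted. So in a random ordering of the
  vertices, each vertex sees two nonadjacent earlier neighbours with probability at least \<open>1/3\<close> and
  few earlier neighbours only with small probability. The expected rank then exceeds
  \<open>(D + 1/4) * n\<close>, which is more than the rank of \<open>K_n\<close>.
\<close>

section \<open>Matroid rank\<close>

text \<open>No ground set is fixed: one predicate on the finite sets of a possibly infinite type
  carries the matroids of all graphs at once, and ranks are taken of finite sets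
  \<open>F\<close>.\<close>

locale finitary_matroid =
  fixes indep :: "'b set \<Rightarrow> bool"
  assumes indep_finite: "indep X \<Longrightarrow> finite X"
    and indep_empty: "indep {}"
    and indep_subset: "indep X \<Longrightarrow> Y \<subseteq> X \<Longrightarrow> indep Y"
    and indep_augment: "indep X \<Longrightarrow> indep Y \<Longrightarrow> card X < card Y \<Longrightarrow> \<exists>y\<in>Y - X. indep (insert y X)"
begin

abbreviation rk :: "'b set \<Rightarrow> nat" where
  "rk F \<equiv> mrank F indep"

lemma card_le_rk: "finite F \<Longrightarrow> X \<subseteq> F \<Longrightarrow> indep X \<Longrightarrow> card X \<le> rk F"
  unfolding mrank_def by (rule Max_ge) auto

lemma basis_exists:
  assumes "finite F"
  obtains X where "X \<subseteq> F" "indep X" "card X = rk F"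
proof -
  have "rk F \<in> card ` {X. X \<subseteq> F \<and> indep X}"
    unfolding mrank_def using assms indep_empty by (intro Max_in) auto
  then show thesis using that by auto
qed

lemma rk_mono: "finite B \<Longrightarrow> A \<subseteq> B \<Longrightarrow> rk A \<le> rk B"
  by (metis basis_exists card_le_rk finite_subset subset_trans)

lemma rk_le_card: "finite F \<Longrightarrow> rk F \<le> card F"
  by (metis basis_exists card_mono)

lemma rk_indep: "indep X \<Longrightarrow> rk X = card X"
  by (meson card_le_rk indep_finite le_antisym order_refl rk_le_card)

lemma basis_extend:
  assumes "finite F" "X \<subseteq> F" "indep X"
  obtains Y where "X \<subseteq> Y" "Y \<subseteq> F" "indep Y" "card Y = rk F"
  using assms
proof (induction "rk F - card X" arbitrary: X thesis rule: less_induct)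
  case less
  show ?case
  proof (cases "card X = rk F")
    case True
    then show ?thesis using less.prems by blast
  next
    case False
    then have lt: "card X < rk F" using card_le_rk less.prems by (simp add: le_neq_implies_less)
    obtain B where B: "B \<subseteq> F" "indep B" "card B = rk F" using basis_exists less.prems by blast
    obtain y where y: "y \<in> B - X" "indep (insert y X)"
      using indep_augment[of X B] less.prems B lt by auto
    have "card (insert y X) = Suc (card X)" using y indep_finite[OF less.prems(4)] by auto
    then have "rk F - card (insert y X) < rk F - card X" "insert y X \<subseteq> F"
      using lt y B less.prems by auto
    then show ?thesis using less.hyps[of "insert y X"] less.prems y by (metis insert_subset)
  qed
qed

text \<open>Submodularity as diminishing returns. A basis of \<open>A\<close> is extended to one of
  \<open>B\<close> and then to one of \<open>B \<union> C\<close>; the elements added last stay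
  independent together with the basis of \<open>A\<close>.\<close>

lemma rk_diminishing:
  assumes "finite B" "finite C" "A \<subseteq> B"
  shows "rk (B \<union> C) + rk A \<le> rk B + rk (A \<union> C)"
proof -
  have fA: "finite A" using assms finite_subset by blast
  obtain X where X: "X \<subseteq> A" "indep X" "card X = rk A" using basis_exists fA by blast
  obtain Y where Y: "X \<subseteq> Y" "Y \<subseteq> B" "indep Y" "card Y = rk B"
    using basis_extend[of B X] X assms by blast
  obtain Z where Z: "Y \<subseteq> Z" "Z \<subseteq> B \<union> C" "indep Z" "card Z = rk (B \<union> C)"
    using basis_extend[of "B \<union> C" Y] Y assms by (metis finite_Un le_supI1)
  have fZ: "finite Z" "finite Y" using Z Y indep_finite by auto
  have "card (Z \<inter> B) \<le> rk B" using card_le_rk[of B "Z \<inter> B"] assms Z(3) indep_subset by blast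
  \<comment> \<open>\<open>Y\<close> already has full rank in \<open>B\<close>, so the elements of
    \<open>Z - Y\<close> all come from \<open>C\<close>.\<close>
  then have "Z \<inter> B = Y" using Y Z fZ by (metis card_seteq finite_Int le_inf_iff)
  then have W: "X \<union> (Z - Y) \<subseteq> A \<union> C" using X Z by auto
  have "X \<union> (Z - Y) \<subseteq> Z" using Y(1) Z(1) by auto
  then have "indep (X \<union> (Z - Y))" by (rule indep_subset[OF Z(3)])
  then have "card (X \<union> (Z - Y)) \<le> rk (A \<union> C)" using card_le_rk[of "A \<union> C"] W fA assms by auto
  moreover have "card (X \<union> (Z - Y)) = card X + (card Z - card Y)"
    using fZ Y Z by (subst card_Un_disjoint) (auto simp: card_Diff_subset finite_subset)
  moreover have "card Y \<le> card Z" using Z fZ card_mono by blast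
  ultimately show ?thesis using X Y Z by linarith
qed

text \<open>An increment of zero over \<open>A\<close> stays zero over \<open>B\<close>. This is how
  edges spanned by a subgraph are seen to be spanned by the whole graph.\<close>

lemma rk_closed_mono:
  assumes "finite B" "finite C" "A \<subseteq> B" "rk (A \<union> C) \<le> rk A"
  shows "rk (B \<union> C) = rk B"
  using rk_diminishing[OF assms(1-3)] assms(4) rk_mono[of "B \<union> C" B] assms by auto

end

section \<open>Graphs\<close>

abbreviation (input) gimage :: "('a \<Rightarrow> 'b) \<Rightarrow> 'a graph \<Rightarrow> 'b graph" where
  "gimage f F \<equiv> (\<lambda>e. f ` e) ` F"

definition star :: "'a \<Rightarrow> 'a set \<Rightarrow> 'a graph" where
  "star v S = (\<lambda>s. {v, s}) ` S"

text \<open>A union of stars, so that the vertices of \<open>T\<close> can be attached one by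
  one.\<close>

definition bipartite :: "'a set \<Rightarrow> 'a set \<Rightarrow> 'a graph" where
  "bipartite S T = (\<Union>t\<in>T. star t S)"

text \<open>A graph being its edge set, vertices of \<open>W\<close> without neighbours in
  \<open>W\<close> are lost: \<open>verts (induced G W)\<close> can be smaller than
  \<open>W\<close>.\<close>

definition induced :: "'a graph \<Rightarrow> 'a set \<Rightarrow> 'a graph" where
  "induced G W = {e \<in> G. e \<subseteq> W}"

definition nbrs :: "'a graph \<Rightarrow> 'a \<Rightarrow> 'a set" where
  "nbrs G v = {u. {v, u} \<in> G}"

lemma graph_finite: "is_graph G \<Longrightarrow> finite G"
  by (simp add: is_graph_def)

lemma graph_subset: "is_graph G \<Longrightarrow> H \<subseteq> G \<Longrightarrow> is_graph H"
  by (auto simp: is_graph_def intro: finite_subset)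

lemma graph_Un: "is_graph G \<Longrightarrow> is_graph H \<Longrightarrow> is_graph (G \<union> H)"
  by (auto simp: is_graph_def)

lemma graph_edgeE:
  assumes "is_graph G" "e \<in> G"
  obtains u v where "e = {u, v}" "u \<noteq> v" "u \<in> verts G" "v \<in> verts G"
proof -
  have "card e = 2" using assms by (simp add: is_graph_def)
  then obtain u v where "e = {u, v}" "u \<noteq> v" by (auto simp: card_2_iff)
  then show thesis using that[of u v] assms(2) by (auto simp: verts_def)
qed

lemma finite_verts: "is_graph G \<Longrightarrow> finite (verts G)"
  unfolding is_graph_def verts_def by (metis card_ge_0_finite finite_Union zero_less_numeral)

lemma verts_mono: "F \<subseteq> G \<Longrightarrow> verts F \<subseteq> verts G"
  by (auto simp: verts_def)

lemma verts_Un: "verts (F \<union> G) = verts F \<union> verts G"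
  by (auto simp: verts_def)

lemma complete_subset_Pow: "complete_graph V \<subseteq> Pow V"
  by (auto simp: complete_graph_def)

lemma complete_graph_graph: "finite V \<Longrightarrow> is_graph (complete_graph V)"
  using finite_subset[OF complete_subset_Pow, of V]
  by (auto simp: is_graph_def complete_graph_def)

lemma complete_graph_mono: "V \<subseteq> W \<Longrightarrow> complete_graph V \<subseteq> complete_graph W"
  by (auto simp: complete_graph_def)

lemma complete_graph_iff: "{u, v} \<in> complete_graph V \<longleftrightarrow> u \<in> V \<and> v \<in> V \<and> u \<noteq> v"
  by (auto simp: complete_graph_def doubleton_eq_iff)

lemma graph_subset_complete: "is_graph G \<Longrightarrow> verts G \<subseteq> V \<Longrightarrow> G \<subseteq> complete_graph V"
  by (auto elim!: graph_edgeE simp: complete_graph_iff)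

lemma verts_complete_subset: "verts (complete_graph V) \<subseteq> V"
  by (auto simp: complete_graph_def verts_def)

lemma verts_star_subset: "verts (star v S) \<subseteq> insert v S"
  by (auto simp: star_def verts_def)

lemma star_graph: "finite S \<Longrightarrow> v \<notin> S \<Longrightarrow> is_graph (star v S)"
  by (auto simp: is_graph_def star_def card_insert_if)

lemma star_mono: "S \<subseteq> T \<Longrightarrow> star v S \<subseteq> star v T"
  by (auto simp: star_def)

lemma card_star: "card (star v S) = card S"
  unfolding star_def by (rule card_image) (auto simp: inj_on_def doubleton_eq_iff)

lemma bipartite_graph: "finite S \<Longrightarrow> finite T \<Longrightarrow> S \<inter> T = {} \<Longrightarrow> is_graph (bipartite S T)"
  by (auto simp: is_graph_def bipartite_def star_def card_insert_if)

lemma bipartite_insert: "bipartite S (insert t T) = bipartite S T \<union> star t S"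
  by (auto simp: bipartite_def)

lemma bipartite_iff:
  "S \<inter> T = {} \<Longrightarrow> s \<in> S \<Longrightarrow> t \<in> T \<Longrightarrow> {s, t} \<in> bipartite S T"
  by (auto simp: bipartite_def star_def)

lemma verts_bipartite_subset: "verts (bipartite S T) \<subseteq> S \<union> T"
  by (auto simp: bipartite_def star_def verts_def)

lemma complete_insert: "v \<notin> V \<Longrightarrow> complete_graph (insert v V) = complete_graph V \<union> star v V"
  by (auto simp: complete_graph_def star_def)

lemma gimage_star: "gimage f (star v S) = star (f v) (f ` S)"
  by (auto simp: star_def image_image)

lemma gimage_complete:
  assumes "inj_on f V"
  shows "gimage f (complete_graph V) = complete_graph (f ` V)"
proof
  show "gimage f (complete_graph V) \<subseteq> complete_graph (f ` V)"
    using assms by (force simp: complete_graph_def inj_on_def)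
  show "complete_graph (f ` V) \<subseteq> gimage f (complete_graph V)"
  proof
    fix e assume "e \<in> complete_graph (f ` V)"
    then obtain u v where "e = f ` {u, v}" "u \<in> V" "v \<in> V" "u \<noteq> v"
      by (auto simp: complete_graph_def)
    then show "e \<in> gimage f (complete_graph V)"
      using complete_graph_iff[of u v V] by blast
  qed
qed

lemma gimage_graph:
  assumes "is_graph F" "inj_on f (verts F)"
  shows "is_graph (gimage f F)"
proof -
  have "card (f ` e) = card e" if "e \<in> F" for e
    using assms(2) that by (intro card_image) (auto simp: verts_def inj_on_def)
  then show ?thesis using assms(1) by (auto simp: is_graph_def)
qed

lemma verts_gimage: "verts (gimage f F) = f ` verts F"
  by (auto simp: verts_def)

lemma gimage_id_on: "(\<And>x. x \<in> verts F \<Longrightarrow> f x = x) \<Longrightarrow> gimage f F = F"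
proof -
  assume a: "\<And>x. x \<in> verts F \<Longrightarrow> f x = x"
  have "f ` e = e" if "e \<in> F" for e using a that by (force simp: verts_def)
  then show ?thesis by simp
qed

lemma induced_insert:
  assumes "is_graph G" "v \<notin> W"
  shows "induced G (insert v W) = induced G W \<union> star v (nbrs G v \<inter> W)"
proof
  show "induced G (insert v W) \<subseteq> induced G W \<union> star v (nbrs G v \<inter> W)"
  proof
    fix e assume e: "e \<in> induced G (insert v W)"
    then obtain a b where ab: "e = {a, b}" "a \<noteq> b"
      using graph_edgeE[OF assms(1)] by (metis (mono_tags, lifting) induced_def mem_Collect_eq)
    show "e \<in> induced G W \<union> star v (nbrs G v \<inter> W)"
    proof (cases "v \<in> e")
      case False
      then show ?thesis using e by (auto simp: induced_def)
    next
      case True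
      then obtain b where "e = {v, b}" "b \<noteq> v" using ab by (metis insertE insert_commute singletonD)
      then show ?thesis using e by (auto simp: induced_def star_def nbrs_def)
    qed
  qed
qed (auto simp: induced_def star_def nbrs_def)

lemma verts_induced: "verts (induced G W) \<subseteq> W"
  by (auto simp: induced_def verts_def)

lemma nbrs_subset_verts: "nbrs G v \<subseteq> verts G"
  by (auto simp: nbrs_def verts_def)

lemma not_in_nbrs: "is_graph G \<Longrightarrow> v \<notin> nbrs G v"
  by (auto simp: nbrs_def is_graph_def)

section \<open>Connectivity\<close>

definition reach_rel :: "'a graph \<Rightarrow> 'a set \<Rightarrow> ('a \<times> 'a) set" where
  "reach_rel G X = {(u, v). {u, v} \<in> G \<and> u \<noteq> v \<and> u \<notin> X \<and> v \<notin> X}"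

lemma reach_rel_iff:
  "(u, v) \<in> reach_rel G X \<longleftrightarrow> {u, v} \<in> G \<and> u \<noteq> v \<and> u \<notin> X \<and> v \<notin> X"
  by (simp add: reach_rel_def)

lemma sym_reach_rel: "sym (reach_rel G X)"
  unfolding sym_def reach_rel_iff by (auto simp: insert_commute)

lemma k_connected_iff:
  "k_connected c G \<longleftrightarrow> c < card (verts G) \<and>
    (\<forall>X. X \<subseteq> verts G \<and> card X < c \<longrightarrow>
      (\<forall>u\<in>verts G - X. \<forall>v\<in>verts G - X. (u, v) \<in> (reach_rel G X)\<^sup>*))"
proof -
  have "adj {e \<in> G. e \<inter> X = {}} \<inter> (verts G - X) \<times> (verts G - X) = reach_rel G X" for X
    by (auto simp: adj_def verts_def reach_rel_def)
  then show ?thesis by (simp add: k_connected_def connected_on_def)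
qed

text \<open>Reachability is symmetric, so it suffices that after each deletion all surviving
  vertices reach a common \<open>h\<close>.\<close>

lemma k_connected_hub:
  assumes "c < card (verts G)"
    and hub: "\<And>X. card X < c \<Longrightarrow> X \<subseteq> verts G \<Longrightarrow> \<exists>h. \<forall>y\<in>verts G - X. (y, h) \<in> (reach_rel G X)\<^sup>*"
  shows "k_connected c G"
  unfolding k_connected_iff
proof (intro conjI allI impI ballI)
  fix X u v
  assume X: "X \<subseteq> verts G \<and> card X < c" and uv: "u \<in> verts G - X" "v \<in> verts G - X"
  obtain h where h: "(u, h) \<in> (reach_rel G X)\<^sup>*" "(v, h) \<in> (reach_rel G X)\<^sup>*"
    using hub[of X] X uv by blast
  have "(h, v) \<in> (reach_rel G X)\<^sup>*"
    using sym_rtrancl[OF sym_reach_rel] h(2) by (rule symD)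
  with h(1) show "(u, v) \<in> (reach_rel G X)\<^sup>*" by (rule rtrancl_trans)
qed (use assms in auto)

lemma k_connectedD:
  "k_connected c G \<Longrightarrow> X \<subseteq> verts G \<Longrightarrow> card X < c \<Longrightarrow> u \<in> verts G - X \<Longrightarrow> v \<in> verts G - X
    \<Longrightarrow> (u, v) \<in> (reach_rel G X)\<^sup>*"
  by (simp add: k_connected_iff)

lemma k_connected_superset:
  assumes "k_connected c G" "G \<subseteq> G'" "verts G' = verts G"
  shows "k_connected c G'"
proof -
  have "reach_rel G X \<subseteq> reach_rel G' X" for X
    using assms by (auto simp: reach_rel_def)
  then have "(reach_rel G X)\<^sup>* \<subseteq> (reach_rel G' X)\<^sup>*" for X
    by (rule rtrancl_mono)
  then show ?thesis
    using assms(1) unfolding k_connected_iff assms(3) by blast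
qed

text \<open>If \<open>v\<close> had fewer than \<open>c\<close> neighbours, deleting them would
  isolate \<open>v\<close>, while another vertex would remain because there are more than
  \<open>c\<close> vertices.\<close>

lemma k_connected_degree:
  assumes "is_graph G" "k_connected c G" "v \<in> verts G"
  shows "c \<le> card (nbrs G v)"
proof (rule ccontr)
  assume "\<not> c \<le> card (nbrs G v)"
  then have lt: "card (nbrs G v) < c" by simp
  have fin: "finite (nbrs G v)"
    using nbrs_subset_verts finite_verts assms(1) finite_subset by metis
  have "card (insert v (nbrs G v)) < card (verts G)"
    using lt fin assms(2) by (auto simp: k_connected_def card_insert_if)
  then have "\<not> verts G \<subseteq> insert v (nbrs G v)"
    using fin card_mono[of "insert v (nbrs G v)" "verts G"] by (auto simp del: card_insert_disjoint)
  then obtain u where u: "u \<in> verts G" "u \<noteq> v" "u \<notin> nbrs G v" by auto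
  have "(v, u) \<in> (reach_rel G (nbrs G v))\<^sup>*"
    using k_connectedD[OF assms(2) nbrs_subset_verts lt, of v u] u assms not_in_nbrs[of G v] by auto
  then obtain x where "(v, x) \<in> reach_rel G (nbrs G v)"
    using u(2) by (metis converse_rtranclE)
  then show False unfolding reach_rel_iff by (auto simp: nbrs_def)
qed

text \<open>A walk through \<open>v\<close> enters and leaves by neighbours of \<open>v\<close>,
  which are equal or adjacent, so it can be cut short. The bound \<open>2 \<le> c\<close> keeps
  every other vertex from losing its only neighbour, and \<open>Suc c < card (verts G)\<close>
  leaves enough vertices.\<close>

lemma k_connected_delete_simplicial:
  assumes G: "is_graph G" "k_connected c G" and "2 \<le> c" "Suc c < card (verts G)" "v \<in> verts G"
    and clique: "\<And>u w. u \<in> nbrs G v \<Longrightarrow> w \<in> nbrs G v \<Longrightarrow> u \<noteq> w \<Longrightarrow> {u, w} \<in> G"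
  defines "H \<equiv> induced G (verts G - {v})"
  shows "verts H = verts G - {v}" "k_connected c H"
proof -
  show vH: "verts H = verts G - {v}"
  proof
    show "verts H \<subseteq> verts G - {v}" unfolding H_def by (rule verts_induced)
    show "verts G - {v} \<subseteq> verts H"
    proof
      fix u assume u: "u \<in> verts G - {v}"
      then have "2 \<le> card (nbrs G u)" using k_connected_degree[OF G, of u] assms(3) by auto
      then have "\<not> nbrs G u \<subseteq> {v}"
        using card_mono[of "{v}" "nbrs G u"] by auto
      then obtain w where w: "w \<in> nbrs G u" "w \<noteq> v" by auto
      then have "{u, w} \<in> H"
        using u nbrs_subset_verts[of G u] by (auto simp: H_def induced_def nbrs_def)
      then show "u \<in> verts H" by (auto simp: verts_def)
    qed
  qed
  have edge_H: "{a, b} \<in> H" if "{a, b} \<in> G" "a \<noteq> v" "b \<noteq> v" for a b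
    using that by (auto simp: H_def induced_def verts_def)
  \<comment> \<open>Invariant along a walk from \<open>a\<close>: when it is off \<open>v\<close>,
    its endpoint is reachable in \<open>H\<close>; when it sits at \<open>v\<close>, some surviving
    neighbour of \<open>v\<close> is reachable instead.\<close>
  have avoid: "(z \<noteq> v \<longrightarrow> (a, z) \<in> (reach_rel H X)\<^sup>*) \<and>
      (z = v \<longrightarrow> (\<exists>y. y \<in> nbrs G v \<and> y \<notin> X \<and> (a, y) \<in> (reach_rel H X)\<^sup>*))"
    if "(a, z) \<in> (reach_rel G X)\<^sup>*" "a \<noteq> v" "v \<notin> X" for a z X
    using that(1)
  proof (induction rule: rtrancl_induct)
    case base
    then show ?case using that by auto
  next
    case (step y z)
    have e: "{y, z} \<in> G" "y \<noteq> z" "y \<notin> X" "z \<notin> X" using step.hyps(2) unfolding reach_rel_iff by auto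
    consider "y \<noteq> v" "z \<noteq> v" | "z = v" | "y = v" by auto
    then show ?case
    proof cases
      case 1
      then have "(y, z) \<in> reach_rel H X" unfolding reach_rel_iff using e edge_H by auto
      then show ?thesis using 1 step.IH by (auto intro: rtrancl_into_rtrancl)
    next
      case 2
      then have "y \<in> nbrs G v" using e by (auto simp: nbrs_def insert_commute)
      then show ?thesis using 2 e step.IH by auto
    next
      case 3
      then obtain x where x: "x \<in> nbrs G v" "x \<notin> X" "(a, x) \<in> (reach_rel H X)\<^sup>*"
        using step.IH by auto
      have z: "z \<in> nbrs G v" using e 3 by (auto simp: nbrs_def)
      have "x \<noteq> v" "z \<noteq> v" using x z not_in_nbrs[OF G(1)] by auto
      then have "x = z \<or> (x, z) \<in> reach_rel H X"
        unfolding reach_rel_iff using clique[OF x(1) z] edge_H x e by auto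
      then show ?thesis using x(3) 3 e by (auto intro: rtrancl_into_rtrancl)
    qed
  qed
  show "k_connected c H"
    unfolding k_connected_iff
  proof (intro conjI allI impI ballI)
    show "c < card (verts H)"
      using assms(4,5) finite_verts[OF G(1)] by (simp add: vH)
    fix X u w
    assume X: "X \<subseteq> verts H \<and> card X < c" and uw: "u \<in> verts H - X" "w \<in> verts H - X"
    then have "(u, w) \<in> (reach_rel G X)\<^sup>*"
      using k_connectedD[OF G(2), of X u w] by (auto simp: vH)
    then show "(u, w) \<in> (reach_rel H X)\<^sup>*"
      using avoid[of u w X] X uw by (auto simp: vH)
  qed
qed

section \<open>Positions in random orderings\<close>

definition position :: "('a \<Rightarrow> nat) \<Rightarrow> 'a set \<Rightarrow> 'a \<Rightarrow> nat" where
  "position h W x = card {y \<in> W. h y < h x}"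

lemma bij_betw_position:
  assumes "finite W" "inj_on h W"
  shows "bij_betw (position h W) W {..<card W}"
proof -
  have less: "position h W x < position h W y" if "x \<in> W" "y \<in> W" "h x < h y" for x y
    unfolding position_def using assms that by (intro psubset_card_mono) auto
  have inj: "inj_on (position h W) W"
  proof (rule inj_onI)
    fix x y assume "x \<in> W" "y \<in> W" "position h W x = position h W y"
    then show "x = y"
      using less[of x y] less[of y x] inj_onD[OF assms(2), of x y] by (metis nat_neq_iff)
  qed
  have "position h W x < card W" if "x \<in> W" for x
    unfolding position_def using assms that by (intro psubset_card_mono) auto
  then have "position h W ` W \<subseteq> {..<card W}" by auto
  then have "position h W ` W = {..<card W}"
    using card_image[OF inj] by (intro card_subset_eq) auto
  then show ?thesis using inj by (simp add: bij_betw_def)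
qed

text \<open>Precomposing with the transposition of \<open>v\<close> and \<open>x\<close> shows that
  all \<open>x\<close> in \<open>W\<close> have the same count. Summing over \<open>x\<close> counts
  pairs, and for a fixed \<open>p\<close> the positions run exactly once through
  \<open>{..<card W}\<close>. This is uniformity of a random position, cleared of
  denominators.\<close>

lemma position_uniform:
  fixes h :: "'a \<Rightarrow> nat"
  assumes "finite V" "inj_on h V" "W \<subseteq> V" "v \<in> W"
  shows "card W * card {p. p permutes V \<and> Q (position (h \<circ> p) W v)} =
    card {p. p permutes V} * card {j. j < card W \<and> Q j}"
proof -
  let ?P = "{p. p permutes V}"
  have finP: "finite ?P" using assms(1) by (rule finite_permutations)
  have finW: "finite W" using assms finite_subset by blast
  have symm: "card {p \<in> ?P. Q (position (h \<circ> p) W x)} = card {p \<in> ?P. Q (position (h \<circ> p) W v)}"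
    if x: "x \<in> W" for x
  proof -
    let ?t = "transpose x v"
    have tV: "?t permutes V" using x assms by (intro permutes_swap_id) auto
    have tt: "p \<circ> ?t \<circ> ?t = p" for p :: "'a \<Rightarrow> 'a"
      by (simp add: comp_assoc)
    have tW: "?t ` W = W"
      using x assms by (intro permutes_image permutes_swap_id) auto
    have pos: "position (h \<circ> (p \<circ> ?t)) W y = position (h \<circ> p) W (?t y)" for p y
    proof -
      have "?t ` {z \<in> W. (h \<circ> (p \<circ> ?t)) z < (h \<circ> (p \<circ> ?t)) y} =
          {z \<in> W. (h \<circ> p) z < (h \<circ> p) (?t y)}" (is "?t ` ?L = ?R")
      proof (intro equalityI subsetI)
        fix z assume "z \<in> ?t ` ?L"
        then show "z \<in> ?R" using tW by auto
      next
        fix z assume z: "z \<in> ?R"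
        then have "?t z \<in> ?L" using tW by auto
        then have "?t (?t z) \<in> ?t ` ?L" by blast
        then show "z \<in> ?t ` ?L" by simp
      qed
      moreover have "inj_on ?t ?L" by (meson inj_on_subset inj_transpose subset_UNIV)
      ultimately have "card ?R = card ?L" using card_image[of ?t ?L] by simp
      then show ?thesis unfolding position_def by simp
    qed
    have "bij_betw (\<lambda>p. p \<circ> ?t) {p \<in> ?P. Q (position (h \<circ> p) W x)}
        {p \<in> ?P. Q (position (h \<circ> p) W v)}"
    proof (rule bij_betw_byWitness[where f' = "\<lambda>p. p \<circ> ?t"])
      have mem: "p \<circ> ?t \<in> ?P" if "p \<in> ?P" for p
        using permutes_compose[OF tV, of p] that by simp
      show "(\<lambda>p. p \<circ> ?t) ` {p \<in> ?P. Q (position (h \<circ> p) W x)} \<subseteq> {p \<in> ?P. Q (position (h \<circ> p) W v)}"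
        using mem by (simp add: image_subset_iff pos)
      show "(\<lambda>p. p \<circ> ?t) ` {p \<in> ?P. Q (position (h \<circ> p) W v)} \<subseteq> {p \<in> ?P. Q (position (h \<circ> p) W x)}"
        using mem by (simp add: image_subset_iff pos)
    qed (simp_all add: tt)
    then show ?thesis by (rule bij_betw_same_card)
  qed
  have count: "card {x \<in> W. Q (position (h \<circ> p) W x)} = card {j. j < card W \<and> Q j}"
    if p: "p permutes V" for p
  proof -
    have "inj_on (h \<circ> p) W"
    proof (rule inj_on_subset[OF comp_inj_on assms(3)])
      show "inj_on p V" using p by (rule permutes_inj_on)
      show "inj_on h (p ` V)" using assms(2) p by (simp add: permutes_image)
    qed
    then have b: "bij_betw (position (h \<circ> p) W) W {..<card W}"
      by (rule bij_betw_position[OF finW])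
    then have "position (h \<circ> p) W ` {x \<in> W. Q (position (h \<circ> p) W x)} = {j. j < card W \<and> Q j}"
      unfolding bij_betw_def by (auto simp: set_eq_iff image_iff) metis
    then show ?thesis
      using b card_image[of "position (h \<circ> p) W" "{x \<in> W. Q (position (h \<circ> p) W x)}"]
      by (auto simp: bij_betw_def inj_on_def)
  qed
  have "card W * card {p \<in> ?P. Q (position (h \<circ> p) W v)} =
      (\<Sum>x\<in>W. card {p \<in> ?P. Q (position (h \<circ> p) W x)})"
    using symm by simp
  also have "\<dots> = (\<Sum>x\<in>W. \<Sum>p\<in>?P. if Q (position (h \<circ> p) W x) then 1 else 0)"
    using finP by (simp add: sum.If_cases Int_def)
  also have "\<dots> = (\<Sum>p\<in>?P. \<Sum>x\<in>W. if Q (position (h \<circ> p) W x) then 1 else 0)"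
    by (rule sum.swap)
  also have "\<dots> = (\<Sum>p\<in>?P. card {x \<in> W. Q (position (h \<circ> p) W x)})"
    using finW by (simp add: sum.If_cases Int_def)
  also have "\<dots> = card ?P * card {j. j < card W \<and> Q j}"
    using count by simp
  finally show ?thesis by simp
qed

section \<open>Matroid union\<close>

text \<open>The union of \<open>union_family\<close>, for independence predicates that need no
  ambient graph.\<close>

definition union_indep :: "(nat \<Rightarrow> 'b set \<Rightarrow> bool) \<Rightarrow> nat \<Rightarrow> 'b set \<Rightarrow> bool" where
  "union_indep Is k X \<longleftrightarrow> (\<exists>Xs. (\<forall>i<k. Is i (Xs i)) \<and> X = (\<Union>i<k. Xs i))"

locale matroid_sequence =
  fixes Is :: "nat \<Rightarrow> 'b set \<Rightarrow> bool" and k :: nat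
  assumes matroids: "i < k \<Longrightarrow> finitary_matroid (Is i)"
begin

text \<open>Independence is hereditary, so a covering can be thinned to a partition. Encoded as a
  colouring, it allows a single element to be recoloured.\<close>

lemma union_indep_colouring:
  "union_indep Is k X \<longleftrightarrow> (\<exists>f. (\<forall>x\<in>X. f x < k) \<and> (\<forall>i<k. Is i {x \<in> X. f x = i}))"
proof
  assume "union_indep Is k X"
  then obtain Xs where Xs: "\<forall>i<k. Is i (Xs i)" "X = (\<Union>i<k. Xs i)"
    by (auto simp: union_indep_def)
  then have "\<forall>x\<in>X. \<exists>i. i < k \<and> x \<in> Xs i" by auto
  then obtain f where f: "\<forall>x\<in>X. f x < k \<and> x \<in> Xs (f x)" by metis
  have "Is i {x \<in> X. f x = i}" if "i < k" for i
  proof (rule finitary_matroid.indep_subset[OF matroids[OF that]])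
    show "Is i (Xs i)" using Xs(1) that by simp
    show "{x \<in> X. f x = i} \<subseteq> Xs i" using f by auto
  qed
  then show "\<exists>f. (\<forall>x\<in>X. f x < k) \<and> (\<forall>i<k. Is i {x \<in> X. f x = i})" using f by blast
next
  assume "\<exists>f. (\<forall>x\<in>X. f x < k) \<and> (\<forall>i<k. Is i {x \<in> X. f x = i})"
  then obtain f where f: "\<forall>x\<in>X. f x < k" "\<forall>i<k. Is i {x \<in> X. f x = i}" by blast
  then have "X = (\<Union>i<k. {x \<in> X. f x = i})" by auto
  then show "union_indep Is k X" unfolding union_indep_def using f(2) by (intro exI[of _ "\<lambda>i. {x \<in> X. f x = i}"]) auto
qed

lemma union_indep_finite: "union_indep Is k X \<Longrightarrow> finite X"
  unfolding union_indep_def using finitary_matroid.indep_finite[OF matroids] by auto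

lemma card_colour_classes:
  assumes "finite X" "\<forall>x\<in>X. f x < k"
  shows "card X = (\<Sum>i<k. card {x \<in> X. f x = i})"
proof -
  have "X = (\<Union>i<k. {x \<in> X. f x = i})" using assms(2) by auto
  then have "card X = card (\<Union>i<k. {x \<in> X. f x = i})" by simp
  also have "\<dots> = (\<Sum>i<k. card {x \<in> X. f x = i})"
    using assms(1) by (intro card_UN_disjoint) auto
  finally show ?thesis .
qed

text \<open>Among the colourings of \<open>X\<close>, one agreeing as much as possible with a
  colouring of \<open>Y\<close> is fixed. Some colour class of \<open>Y\<close> is larger than that
  of \<open>X\<close>, and augmentation in this colour yields \<open>y\<close>. If \<open>y\<close>
  were in \<open>X\<close>, recolouring it would increase the agreement; so \<open>y\<close> is
  new.\<close>

lemma union_indep_augment: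
  assumes X: "union_indep Is k X" and Y: "union_indep Is k Y" and lt: "card X < card Y"
  shows "\<exists>y\<in>Y - X. union_indep Is k (insert y X)"
proof (rule ccontr)
  assume no: "\<not> (\<exists>y\<in>Y - X. union_indep Is k (insert y X))"
  have fin: "finite X" "finite Y" using X Y union_indep_finite by auto
  define col where "col f X \<longleftrightarrow> (\<forall>x\<in>X. f x < k) \<and> (\<forall>i<k. Is i {x \<in> X. f x = i})" for f X
  obtain g where g: "col g Y" using Y unfolding union_indep_colouring col_def by blast
  define agree where "agree f = card {x \<in> X \<inter> Y. f x = g x}" for f
  obtain f0 where f0: "col f0 X" using X unfolding union_indep_colouring col_def by blast
  have "agree f \<le> card X" for f
    unfolding agree_def using fin by (intro card_mono) auto
  then have bound: "\<forall>f. col f X \<longrightarrow> agree f < Suc (card X)" by (simp add: less_Suc_eq_le)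
  obtain f where f: "col f X" and f_max: "\<forall>f'. col f' X \<longrightarrow> agree f' \<le> agree f"
    using ex_has_greatest_nat[OF f0 bound] by (elim exE conjE)
  have "(\<Sum>i<k. card {x \<in> X. f x = i}) < (\<Sum>i<k. card {x \<in> Y. g x = i})"
    using lt f g fin card_colour_classes[of X f] card_colour_classes[of Y g]
    unfolding col_def by simp
  then obtain i where i: "i < k" "card {x \<in> X. f x = i} < card {x \<in> Y. g x = i}"
    by (metis (no_types, lifting) lessThan_iff linorder_not_le sum_mono)
  then obtain y where y: "y \<in> Y" "g y = i" "\<not> (y \<in> X \<and> f y = i)"
      and ind: "Is i (insert y {x \<in> X. f x = i})"
    using finitary_matroid.indep_augment[OF matroids[OF i(1)], of "{x \<in> X. f x = i}" "{x \<in> Y. g x = i}"]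
      f g unfolding col_def by auto
  have col': "col (f(y := i)) (insert y X)"
    unfolding col_def
  proof (intro conjI allI impI)
    show "\<forall>x\<in>insert y X. (f(y := i)) x < k" using f i by (auto simp: col_def)
    fix j assume j: "j < k"
    show "Is j {x \<in> insert y X. (f(y := i)) x = j}"
    proof (cases "j = i")
      case True
      then have "{x \<in> insert y X. (f(y := i)) x = j} = insert y {x \<in> X. f x = i}" by auto
      then show ?thesis using ind True by simp
    next
      case False
      then have sub: "{x \<in> insert y X. (f(y := i)) x = j} \<subseteq> {x \<in> X. f x = j}" by auto
      have "Is j {x \<in> X. f x = j}" using f j by (simp add: col_def)
      then show ?thesis using sub by (rule finitary_matroid.indep_subset[OF matroids[OF j]])
    qed
  qed
  then have "y \<in> X" using no y unfolding union_indep_colouring col_def by blast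
  then have yX: "insert y X = X" by auto
  have "{x \<in> X \<inter> Y. f x = g x} \<subset> {x \<in> X \<inter> Y. (f(y := i)) x = g x}"
    using y \<open>y \<in> X\<close> by auto
  then have "agree f < agree (f(y := i))"
    unfolding agree_def using fin by (intro psubset_card_mono) auto
  moreover have "agree (f(y := i)) \<le> agree f" using f_max col' yX by simp
  ultimately show False by simp
qed

sublocale union: finitary_matroid "union_indep Is k"
proof
  show "finite X" if "union_indep Is k X" for X using that by (rule union_indep_finite)
  show "union_indep Is k {}"
    unfolding union_indep_colouring using finitary_matroid.indep_empty[OF matroids] by simp
  show "union_indep Is k Y" if X: "union_indep Is k X" "Y \<subseteq> X" for X Y
  proof -
    obtain Xs where Xs: "\<forall>i<k. Is i (Xs i)" "X = (\<Union>i<k. Xs i)"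
      using X(1) unfolding union_indep_def by blast
    show ?thesis unfolding union_indep_def
    proof (intro exI[of _ "\<lambda>i. Xs i \<inter> Y"] conjI allI impI)
      show "Is i (Xs i \<inter> Y)" if "i < k" for i
        using finitary_matroid.indep_subset[OF matroids[OF that], of "Xs i"] Xs(1) that by simp
      show "Y = (\<Union>i<k. Xs i \<inter> Y)" using X(2) Xs(2) by auto
    qed
  qed
qed (rule union_indep_augment)

lemma rk_union_le:
  assumes "finite F"
  shows "mrank F (union_indep Is k) \<le> (\<Sum>i<k. mrank F (Is i))"
proof -
  obtain X where X: "X \<subseteq> F" "union_indep Is k X" "card X = mrank F (union_indep Is k)"
    using union.basis_exists[OF assms] by blast
  then obtain f where f: "\<forall>x\<in>X. f x < k" "\<forall>i<k. Is i {x \<in> X. f x = i}"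
    unfolding union_indep_colouring by blast
  have "card {x \<in> X. f x = i} \<le> mrank F (Is i)" if "i < k" for i
    using finitary_matroid.card_le_rk[OF matroids[OF that] assms, of "{x \<in> X. f x = i}"] f(2) X(1) that
    by blast
  then have "(\<Sum>i<k. card {x \<in> X. f x = i}) \<le> (\<Sum>i<k. mrank F (Is i))"
    by (intro sum_mono) auto
  then show ?thesis
    using X(3) card_colour_classes[OF finite_subset[OF X(1) assms] f(1)] by simp
qed

text \<open>Bases of the disjoint sets \<open>Fs i\<close> are disjoint, so their sizes add up.
  Lower bounds for the union come from edge-disjoint pieces in this way.\<close>

lemma rk_union_ge:
  assumes "finite F" and sub: "\<And>i. i < k \<Longrightarrow> Fs i \<subseteq> F"
    and disj: "\<And>i j. i < k \<Longrightarrow> j < k \<Longrightarrow> i \<noteq> j \<Longrightarrow> Fs i \<inter> Fs j = {}"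
  shows "(\<Sum>i<k. mrank (Fs i) (Is i)) \<le> mrank F (union_indep Is k)"
proof -
  have "\<exists>X. X \<subseteq> Fs i \<and> Is i X \<and> card X = mrank (Fs i) (Is i)" if "i < k" for i
    using finitary_matroid.basis_exists[OF matroids[OF that] finite_subset[OF sub[OF that] assms(1)]]
    by blast
  then obtain Xs where Xs: "\<And>i. i < k \<Longrightarrow> Xs i \<subseteq> Fs i"
      "\<And>i. i < k \<Longrightarrow> Is i (Xs i)" "\<And>i. i < k \<Longrightarrow> card (Xs i) = mrank (Fs i) (Is i)"
    by metis
  have fin: "finite (Xs i)" if "i < k" for i
    using finitary_matroid.indep_finite[OF matroids[OF that]] Xs that by blast
  have "(\<Sum>i<k. mrank (Fs i) (Is i)) = card (\<Union>i<k. Xs i)"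
  proof (subst card_UN_disjoint)
    show "\<forall>i\<in>{..<k}. \<forall>j\<in>{..<k}. i \<noteq> j \<longrightarrow> Xs i \<inter> Xs j = {}"
      using Xs(1) disj by (metis disjoint_iff lessThan_iff subsetD)
  qed (use Xs fin in auto)
  also have "\<dots> \<le> mrank F (union_indep Is k)"
  proof (rule union.card_le_rk[OF assms(1)])
    show "(\<Union>i<k. Xs i) \<subseteq> F" using Xs(1) sub by blast
    show "union_indep Is k (\<Union>i<k. Xs i)" unfolding union_indep_def using Xs(2) by blast
  qed
  finally show ?thesis .
qed

end

section \<open>Graph matroids and their slope\<close>

text \<open>A whole graph matroid family becomes one predicate on finite graphs; isomorphism
  invariance becomes invariance under maps that are injective on the vertices.\<close>

locale graph_matroid = finitary_matroid indep for indep :: "'a graph \<Rightarrow> bool" +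
  assumes indep_graph: "indep X \<Longrightarrow> is_graph X"
    and indep_gimage: "indep X \<Longrightarrow> inj_on f (verts X) \<Longrightarrow> indep (gimage f X)"
begin

lemma rk_gimage_ge:
  assumes "is_graph F" "inj_on f (verts F)"
  shows "rk F \<le> rk (gimage f F)"
proof -
  obtain X where X: "X \<subseteq> F" "indep X" "card X = rk F"
    using basis_exists[OF graph_finite[OF assms(1)]] by blast
  have inj: "inj_on f (verts X)" using assms(2) verts_mono[OF X(1)] by (rule inj_on_subset)
  then have "card (gimage f X) = card X"
    unfolding verts_def by (intro card_image inj_on_image)
  moreover have "card (gimage f X) \<le> rk (gimage f F)"
    using X inj graph_finite[OF assms(1)] by (intro card_le_rk indep_gimage) auto
  ultimately show ?thesis using X(3) by simp
qed

lemma rk_gimage: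
  assumes "is_graph F" "inj_on f (verts F)"
  shows "rk (gimage f F) = rk F"
proof (rule antisym)
  let ?g = "inv_into (verts F) f"
  have "gimage ?g (gimage f F) = gimage (?g \<circ> f) F" by (simp add: image_image)
  also have "\<dots> = F" using assms(2) by (intro gimage_id_on) simp
  finally have "gimage ?g (gimage f F) = F" .
  moreover have "inj_on ?g (verts (gimage f F))"
    unfolding verts_gimage by (rule inj_on_inv_into) simp
  ultimately show "rk (gimage f F) \<le> rk F"
    using rk_gimage_ge[OF gimage_graph[OF assms], of ?g] by simp
qed (rule rk_gimage_ge[OF assms])

lemma rk_complete_card:
  assumes "finite V" "finite W" "card V = card W"
  shows "rk (complete_graph V) = rk (complete_graph W)"
proof -
  obtain f where f: "bij_betw f V W" using finite_same_card_bij[OF assms] by blast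
  then have inj: "inj_on f V" and im: "f ` V = W" by (auto simp: bij_betw_def)
  have "rk (gimage f (complete_graph V)) = rk (complete_graph V)"
    using inj verts_complete_subset by (intro rk_gimage complete_graph_graph assms inj_on_subset[OF inj])
  then show ?thesis using gimage_complete[OF inj] im by simp
qed

end

lemma ex_large_superset:
  assumes "infinite (UNIV :: 'a set)" "finite A" "(v :: 'a) \<notin> A"
  obtains V where "finite V" "A \<subseteq> V" "v \<notin> V" "n \<le> card V"
proof -
  have "infinite (UNIV - insert v A)" using assms by (simp add: Diff_infinite_finite)
  then obtain B where B: "finite B" "card B = n" "B \<subseteq> UNIV - insert v A"
    using infinite_arbitrarily_large by blast
  then have "n \<le> card (A \<union> B)" using assms(2) card_mono[of "A \<union> B" B] by auto
  then show thesis using that[of "A \<union> B"] B assms by auto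
qed

section \<open>Slope of the complete graphs and extension by stars\<close>

text \<open>\<open>G\<close> is the complete graph on \<open>V\<close> and two further vertices with
  only the edge \<open>{u, v}\<close> missing. Any vertex of \<open>V\<close> that survives a
  deletion is adjacent to all others and serves as hub.\<close>

lemma k_connected_complete_minus_edge:
  assumes "finite V" "c \<le> card V" "V \<noteq> {}" "u \<notin> V" "v \<notin> V" "u \<noteq> v"
  defines "G \<equiv> complete_graph V \<union> star u V \<union> star v V"
  shows "is_graph G" "verts G = insert u (insert v V)" "k_connected c G"
proof -
  show "is_graph G" unfolding G_def
    using assms by (intro graph_Un complete_graph_graph star_graph) auto
  show vG: "verts G = insert u (insert v V)"
    using assms(3) verts_complete_subset[of V] unfolding G_def verts_Un
    by (auto simp: verts_def star_def)
  show "k_connected c G"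
  proof (rule k_connected_hub)
    show "c < card (verts G)" using assms(1-6) by (simp add: vG)
    fix X assume X: "card X < c" "X \<subseteq> verts G"
    then have "\<not> V \<subseteq> X"
      using assms(1,2) card_mono[of X V] finite_subset[of X "verts G"] vG by auto
    then obtain h where h: "h \<in> V" "h \<notin> X" by auto
    have "(y, h) \<in> (reach_rel G X)\<^sup>*" if "y \<in> verts G - X" for y
    proof (cases "y = h")
      case False
      then have "{y, h} \<in> G" using that h unfolding vG
        by (auto simp: G_def complete_graph_iff star_def)
      then show ?thesis using False that h by (auto simp: reach_rel_iff)
    qed simp
    then show "\<exists>h. \<forall>y\<in>verts G - X. (y, h) \<in> (reach_rel G X)\<^sup>*" by blast
  qed
qed

text \<open>An infinite vertex type provides fresh vertices and arbitrarily large complete graphs;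
  finite types are treated separately in \<open>theorem3p18\<close>.\<close>

locale lovasz_yemini_matroid = graph_matroid indep for indep :: "'a graph \<Rightarrow> bool" +
  fixes c :: nat
  assumes infinite_univ: "infinite (UNIV :: 'a set)"
    and rk_connected: "is_graph G \<Longrightarrow> k_connected c G \<Longrightarrow> rk G = rk (complete_graph (verts G))"
begin

text \<open>The complete graph without \<open>{u, v}\<close> is rigid and arises from
  \<open>complete_graph V\<close> by adding two stars, so diminishing returns for these stars
  amounts to concavity of the rank.\<close>

lemma rk_complete_concave:
  assumes "finite V" "c \<le> card V" "V \<noteq> {}" "u \<notin> V" "v \<notin> V" "u \<noteq> v"
  shows "rk (complete_graph (insert u (insert v V))) + rk (complete_graph V) \<le>
    rk (complete_graph (insert u V)) + rk (complete_graph (insert v V))"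
proof -
  note G = k_connected_complete_minus_edge[OF assms]
  have "rk (complete_graph V \<union> star u V \<union> star v V) + rk (complete_graph V) \<le>
      rk (complete_graph V \<union> star u V) + rk (complete_graph V \<union> star v V)"
    using G(1) by (intro rk_diminishing) (auto dest: graph_finite)
  then show ?thesis
    using rk_connected[OF G(1,3)] G(2) assms by (simp add: complete_insert)
qed

text \<open>By concavity the rank increments of complete graphs are eventually nonincreasing; as
  natural numbers they become constant, and \<open>D\<close> is that constant.\<close>

lemma slope_exists:
  obtains D n0 where "\<And>V v. finite V \<Longrightarrow> n0 \<le> card V \<Longrightarrow> v \<notin> V \<Longrightarrow>
    rk (complete_graph (insert v V)) = rk (complete_graph V) + D"
proof -
  obtain e :: "nat \<Rightarrow> 'a" where e: "inj e"
    using infinite_countable_subset[OF infinite_univ] by blast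
  define R where "R n = rk (complete_graph (e ` {..<n}))" for n
  have card_e: "card (e ` {..<n}) = n" for n
    using e by (subst card_image) (auto simp: inj_on_def)
  have R: "rk (complete_graph V) = R (card V)" if "finite V" for V
    unfolding R_def using that card_e by (intro rk_complete_card) auto
  have R_mono: "R n \<le> R (Suc n)" for n
    unfolding R_def by (intro rk_mono graph_finite complete_graph_graph complete_graph_mono) auto
  \<comment> \<open>\<open>Suc c\<close> instead of \<open>c\<close>, so that the vertex set is also
    nonempty.\<close>
  have R_concave: "R (Suc (Suc n)) + R n \<le> R (Suc n) + R (Suc n)" if "Suc c \<le> n" for n
  proof -
    let ?V = "e ` {..<n}"
    have "e n \<notin> ?V" "e (Suc n) \<notin> ?V" "e n \<noteq> e (Suc n)" using inj_eq[OF e] by auto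
    then show ?thesis
      using rk_complete_concave[of ?V "e n" "e (Suc n)"] that by (simp add: R card_e lessThan_empty_iff)
  qed
  define d where "d n = R (Suc n) - R n" for n
  \<comment> \<open>From a minimum on, the increment cannot rise by concavity and cannot fall by
    minimality.\<close>
  obtain n0 where n0: "Suc c \<le> n0" and d_min: "\<forall>n. Suc c \<le> n \<longrightarrow> d n0 \<le> d n"
    using ex_has_least_nat[of "\<lambda>n. Suc c \<le> n" "Suc c" d] by auto
  have "d n \<le> d n0" if "n0 \<le> n" for n
    using that
  proof (induction rule: dec_induct)
    case (step n)
    have "d (Suc n) \<le> d n" unfolding d_def
      using R_concave[of n] R_mono[of n] R_mono[of "Suc n"] step n0 by linarith
    then show ?case using step.IH by simp
  qed simp
  then have "d n = d n0" if "n0 \<le> n" for n using that d_min n0 by (simp add: le_antisym)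
  then have "R (Suc n) = R n + d n0" if "n0 \<le> n" for n
    using that R_mono[of n] unfolding d_def by (metis le_add_diff_inverse)
  then show thesis using that[of n0 "d n0"] by (simp add: R)
qed

text \<open>Contracting \<open>complete_graph V\<close> leaves a matroid on the star at \<open>v\<close> with full symmetric
  group action, which must be uniform.\<close>

lemma rk_star_uniform:
  assumes "finite V" "v \<notin> V" "S \<subseteq> V" "card S = D"
    and D: "rk (complete_graph (insert v V)) = rk (complete_graph V) + D"
  shows "rk (complete_graph V) + D \<le> rk (complete_graph V \<union> star v S)"
proof -
  let ?K = "complete_graph V"
  have fin: "finite ?K" "finite (star v V)"
    using assms complete_graph_graph graph_finite by (auto simp: star_def)
  obtain X where X: "X \<subseteq> ?K" "indep X" "card X = rk ?K" using basis_exists[OF fin(1)] by blast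
  obtain Y where Y: "X \<subseteq> Y" "Y \<subseteq> ?K \<union> star v V" "indep Y" "card Y = rk (?K \<union> star v V)"
    using basis_extend[of "?K \<union> star v V" X] X fin by blast
  have finY: "finite Y" using Y indep_finite by blast
  have "indep (Y \<inter> ?K)" using indep_subset[OF Y(3), of "Y \<inter> ?K"] by simp
  then have "card (Y \<inter> ?K) \<le> card X" using card_le_rk[OF fin(1), of "Y \<inter> ?K"] X(3) by simp
  then have YK: "X = Y \<inter> ?K" using X(1) Y(1) finY by (intro card_seteq) auto
  \<comment> \<open>The ends of the star edges that a basis of the larger complete graph adds to a
    basis of \<open>complete_graph V\<close>: one set of size \<open>D\<close> for which the bound
    holds.\<close>
  define S0 where "S0 = {s \<in> V. {v, s} \<in> Y}"
  have YX: "Y - X = star v S0"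
    using Y(2) assms(2) complete_subset_Pow[of V] unfolding YK S0_def star_def by blast
  have "card (Y - X) = D"
    using card_Diff_subset[OF finite_subset[OF Y(1) finY] Y(1)] Y(4) X(3) D assms(2)
    by (simp add: complete_insert)
  then have cS0: "card S0 = D" unfolding YX card_star .
  have S0V: "S0 \<subseteq> V" by (auto simp: S0_def)
  have "Y \<subseteq> ?K \<union> star v S0" using YX X by auto
  moreover have "finite (star v S0)" using star_mono[OF S0V] fin(2) by (rule finite_subset)
  ultimately have ge: "rk ?K + D \<le> rk (?K \<union> star v S0)"
    using card_le_rk[of "?K \<union> star v S0" Y] Y fin D assms(2) by (simp add: complete_insert)
  have finS: "finite S0" "finite S" using S0V assms finite_subset by auto
  obtain g where g: "bij_betw g S0 S"
    using finite_same_card_bij[OF finS] cS0 assms(4) by auto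
  have "card (V - S0) = card (V - S)"
    using S0V assms finS cS0 by (simp add: card_Diff_subset)
  then obtain g' where g': "bij_betw g' (V - S0) (V - S)"
    using finite_same_card_bij[of "V - S0" "V - S"] assms(1) by auto
  \<comment> \<open>A permutation of \<open>V\<close> taking \<open>S0\<close> onto \<open>S\<close>
    and fixing \<open>v\<close>; it preserves \<open>complete_graph V\<close> and carries the bound
    from \<open>S0\<close> to \<open>S\<close>.\<close>
  define f where "f x = (if x \<in> S0 then g x else if x \<in> V then g' x else x)" for x
  have b1: "bij_betw f S0 S" using g by (rule bij_betw_cong[THEN iffD1, rotated]) (simp add: f_def)
  have b2: "bij_betw f (V - S0) (V - S)"
    using g' by (rule bij_betw_cong[THEN iffD1, rotated]) (simp add: f_def)
  have "bij_betw f (S0 \<union> (V - S0)) (S \<union> (V - S))" using b1 b2 by (rule bij_betw_combine) auto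
  then have b3: "bij_betw f V V" using S0V assms(3) by (simp add: Un_absorb1 Un_Diff_cancel)
  have fv: "f v = v" using assms(2) S0V by (auto simp: f_def)
  have inj: "inj_on f (insert v V)" using b3 fv assms(2) by (auto simp: bij_betw_def)
  have "is_graph (?K \<union> star v S0)"
    using assms(1,2) S0V finS by (intro graph_Un complete_graph_graph star_graph) auto
  moreover have "inj_on f (verts (?K \<union> star v S0))"
    using verts_complete_subset[of V] verts_star_subset[of v S0] S0V
    by (intro inj_on_subset[OF inj]) (auto simp: verts_Un)
  ultimately have "rk (gimage f (?K \<union> star v S0)) = rk (?K \<union> star v S0)" by (rule rk_gimage)
  moreover have "gimage f (?K \<union> star v S0) = ?K \<union> star v S"
    using gimage_complete[of f V] gimage_star[of f v S0] b3 b1 fv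
    by (simp add: image_Un bij_betw_def)
  ultimately show ?thesis using ge by simp
qed

text \<open>Over a large complete graph containing \<open>F\<close> and \<open>S\<close> but
  avoiding \<open>v\<close>, \<open>D\<close> of the new edges add \<open>D\<close> to the rank by
  \<open>rk_star_uniform\<close>; over the smaller \<open>F\<close> they add at least as
  much.\<close>

lemma star_extension:
  assumes slope: "\<And>V v. finite V \<Longrightarrow> n0 \<le> card V \<Longrightarrow> v \<notin> V \<Longrightarrow>
      rk (complete_graph (insert v V)) = rk (complete_graph V) + D"
    and F: "is_graph F" "v \<notin> verts F" and S: "finite S" "v \<notin> S" "D \<le> card S"
  shows "rk F + D \<le> rk (F \<union> star v S)"
proof -
  obtain S' where S': "S' \<subseteq> S" "card S' = D" using S(3) obtain_subset_with_card_n by metis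
  obtain V where V: "finite V" "verts F \<union> S \<subseteq> V" "v \<notin> V" "n0 \<le> card V"
    using ex_large_superset[OF infinite_univ, of "verts F \<union> S" v n0] finite_verts F S by auto
  let ?K = "complete_graph V"
  have "finite S'" using S'(1) S(1) by (rule finite_subset)
  then have fin: "finite ?K" "finite (star v S)" "finite F" "finite (star v S')"
    using V complete_graph_graph graph_finite F S by (auto simp: star_def)
  have "rk ?K + D \<le> rk (?K \<union> star v S')"
    using V S' by (intro rk_star_uniform slope) auto
  moreover have "rk (?K \<union> star v S') + rk F \<le> rk ?K + rk (F \<union> star v S')"
    using fin V F by (intro rk_diminishing graph_subset_complete) auto
  moreover have "rk (F \<union> star v S') \<le> rk (F \<union> star v S)"
    using fin star_mono[OF S'(1)] by (intro rk_mono) auto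
  ultimately show ?thesis by linarith
qed

end

section \<open>Rigid complete bipartite graphs suffice\<close>

text \<open>What the averaging argument uses about the union; \<open>union_extendable\<close>
  provides it. \<open>D\<close> is the slope, and \<open>m\<close> a size from which the slope bound
  and the rigidity of complete bipartite graphs hold.\<close>

locale extendable_matroid = graph_matroid indep for indep :: "'a graph \<Rightarrow> bool" +
  fixes D m :: nat
  assumes infinite_univ: "infinite (UNIV :: 'a set)"
    and star_ext: "is_graph F \<Longrightarrow> v \<notin> verts F \<Longrightarrow> finite S \<Longrightarrow> v \<notin> S \<Longrightarrow> D \<le> card S \<Longrightarrow>
      rk F + D \<le> rk (F \<union> star v S)"
    and slope_le: "finite V \<Longrightarrow> m \<le> card V \<Longrightarrow> v \<notin> V \<Longrightarrow>
      rk (complete_graph (insert v V)) \<le> rk (complete_graph V) + D"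
    and bipartite_rigid: "finite S \<Longrightarrow> finite T \<Longrightarrow> S \<inter> T = {} \<Longrightarrow> m \<le> card S \<Longrightarrow> m \<le> card T \<Longrightarrow>
      rk (bipartite S T) = rk (complete_graph (S \<union> T))"
    and D_le_m: "D \<le> m" and m_pos: "0 < m"
begin

text \<open>If attaching \<open>v\<close> to \<open>S\<close> raised the rank by only \<open>D\<close>, then so would attaching each of
  \<open>m\<close> copies of \<open>v\<close>; but these copies span a rigid complete bipartite graph with \<open>S\<close>, so that
  \<open>S\<close> would already be a clique in the closure of \<open>F\<close>.\<close>

lemma star_ext_nonclique:
  assumes F: "is_graph F" "v \<notin> verts F" and S: "finite S" "v \<notin> S" "m \<le> card S"
    and e: "e \<in> complete_graph S" "rk F < rk (insert e F)"
  shows "rk F + D + 1 \<le> rk (F \<union> star v S)"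
proof (rule ccontr)
  assume "\<not> rk F + D + 1 \<le> rk (F \<union> star v S)"
  then have le: "rk (F \<union> star v S) \<le> rk F + D" by simp
  have "infinite (UNIV - (verts F \<union> S))"
    using infinite_univ finite_verts[OF F(1)] S by (simp add: Diff_infinite_finite)
  then obtain T where T: "finite T" "card T = m" "T \<subseteq> UNIV - (verts F \<union> S)"
    using infinite_arbitrarily_large by blast
  have gF: "is_graph (F \<union> star v S)" using F S by (intro graph_Un star_graph) auto
  \<comment> \<open>Swapping \<open>v\<close> and \<open>t\<close>, both outside \<open>F\<close>
    and \<open>S\<close>, fixes \<open>F\<close> and turns one star into the other.\<close>
  have copy: "rk (F \<union> star t S) \<le> rk F + D" if "t \<in> T" for t
  proof -
    let ?f = "transpose v t"
    have "gimage ?f F = F"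
      using F(2) T(3) that by (intro gimage_id_on) (auto simp: transpose_def)
    moreover have "?f ` S = S" using S(2) T(3) that by (force simp: transpose_def)
    ultimately have "gimage ?f (F \<union> star v S) = F \<union> star t S"
      by (simp add: image_Un gimage_star)
    moreover have "rk (gimage ?f (F \<union> star v S)) = rk (F \<union> star v S)"
      by (rule rk_gimage[OF gF]) (meson inj_on_subset inj_transpose subset_UNIV)
    ultimately show ?thesis using le by simp
  qed
  have fin_star: "finite (star t S)" for t using S by (simp add: star_def)
  have fin_bip: "finite (bipartite S T')" if "finite T'" for T'
    using that fin_star by (simp add: bipartite_def)
  have finF: "finite F" using F graph_finite by blast
  \<comment> \<open>Over the larger graph each copy adds at most as much as over \<open>F\<close>,
    hence at most \<open>D\<close>.\<close>
  have upper: "rk (F \<union> bipartite S T') \<le> rk F + card T' * D" if "finite T'" "T' \<subseteq> T" for T'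
    using that
  proof (induction T' rule: finite_induct)
    case empty
    then show ?case by (simp add: bipartite_def)
  next
    case (insert t T')
    have "rk ((F \<union> bipartite S T') \<union> star t S) + rk F \<le> rk (F \<union> bipartite S T') + rk (F \<union> star t S)"
      using finF fin_bip fin_star insert.hyps by (intro rk_diminishing) auto
    then show ?case using insert copy[of t] by (simp add: bipartite_insert Un_assoc)
  qed
  have eS: "e \<subseteq> S" using e(1) complete_subset_Pow by blast
  have ge: "is_graph (insert e F)"
    using F(1) e(1) complete_graph_graph[OF S(1)] by (auto simp: is_graph_def)
  \<comment> \<open>With \<open>e\<close> present from the start, each copy still adds at least
    \<open>D\<close>.\<close>
  have lower: "rk (insert e F) + card T' * D \<le> rk (insert e F \<union> bipartite S T')"
    if "finite T'" "T' \<subseteq> T" for T'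
    using that
  proof (induction T' rule: finite_induct)
    case empty
    then show ?case by (simp add: bipartite_def)
  next
    case (insert t T')
    have "is_graph (insert e F \<union> bipartite S T')"
      using ge insert S T by (intro graph_Un bipartite_graph) auto
    moreover have "t \<notin> verts (insert e F \<union> bipartite S T')"
      using insert eS T(3) verts_bipartite_subset[of S T'] by (auto simp: verts_def)
    ultimately have "rk (insert e F \<union> bipartite S T') + D \<le>
        rk (insert e F \<union> bipartite S T' \<union> star t S)"
      using S insert T(3) D_le_m by (intro star_ext) auto
    then show ?case using insert by (simp add: bipartite_insert Un_assoc)
  qed
  \<comment> \<open>The ends of \<open>e\<close> lie in \<open>S\<close>, so the rigid
    \<open>bipartite S T\<close> spans \<open>e\<close>. Then both bounds concern the same rank,
    although they start from \<open>rk F\<close> and from the larger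
    \<open>rk (insert e F)\<close>.\<close>
  have "rk (bipartite S T \<union> {e}) \<le> rk (complete_graph (S \<union> T))"
  proof (intro rk_mono)
    show "finite (complete_graph (S \<union> T))" using S T complete_graph_graph graph_finite by blast
    have "bipartite S T \<subseteq> complete_graph (S \<union> T)"
      using S T by (intro graph_subset_complete bipartite_graph verts_bipartite_subset) auto
    then show "bipartite S T \<union> {e} \<subseteq> complete_graph (S \<union> T)"
      using e(1) complete_graph_mono[of S "S \<union> T"] by auto
  qed
  also have "\<dots> = rk (bipartite S T)" using S T by (intro bipartite_rigid[symmetric]) auto
  finally have "rk (F \<union> bipartite S T \<union> {e}) = rk (F \<union> bipartite S T)"
    using finF fin_bip T by (intro rk_closed_mono) auto
  then show False using upper[of T] lower[of T] T e(2) by (simp add: Un_commute)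
qed

text \<open>From \<open>m\<close> vertices on, each vertex adds at most \<open>D\<close>;
  \<open>2 ^ m\<close> is a crude bound for the edges among the first \<open>m\<close>.\<close>

lemma rk_complete_le:
  assumes "finite V" "m \<le> card V"
  shows "rk (complete_graph V) \<le> D * card V + 2 ^ m"
proof -
  obtain V0 where V0: "V0 \<subseteq> V" "card V0 = m" "finite V0"
    using assms obtain_subset_with_card_n by (metis finite_subset)
  have "rk (complete_graph (V0 \<union> W)) \<le> rk (complete_graph V0) + D * card W"
    if "finite W" "W \<inter> V0 = {}" for W
    using that
  proof (induction W rule: finite_induct)
    case (insert w W)
    have "rk (complete_graph (insert w (V0 \<union> W))) \<le> rk (complete_graph (V0 \<union> W)) + D"
      using insert V0 card_mono[of "V0 \<union> W" V0] by (intro slope_le) auto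
    then show ?case using insert by simp
  qed simp
  from this[of "V - V0"] have "rk (complete_graph V) \<le> rk (complete_graph V0) + D * card (V - V0)"
    using assms V0 by (simp add: Un_absorb1 Int_commute)
  moreover have "rk (complete_graph V0) \<le> 2 ^ m"
  proof -
    have "rk (complete_graph V0) \<le> card (complete_graph V0)"
      using V0 by (intro rk_le_card graph_finite complete_graph_graph)
    also have "\<dots> \<le> card (Pow V0)" using V0 complete_subset_Pow by (intro card_mono) auto
    finally show ?thesis using V0 by (simp add: card_Pow)
  qed
  moreover have "D * card (V - V0) \<le> D * card V" using assms by (simp add: card_mono)
  ultimately show ?thesis by linarith
qed

section \<open>Averaging over vertex orderings\<close>

text \<open>The induced graphs on initial segments of the ordering \<open>h\<close> grow one vertex
  at a time, and the increments telescope.\<close>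

lemma sum_gain_le_rk:
  fixes h :: "'a \<Rightarrow> nat"
  assumes G: "is_graph G" and h: "inj_on h (verts G)"
    and gain: "\<And>v. v \<in> verts G \<Longrightarrow> rk (induced G {u \<in> verts G. h u < h v}) + gain v \<le>
      rk (induced G {u \<in> verts G. h u < h v} \<union> star v (nbrs G v \<inter> {u \<in> verts G. h u < h v}))"
  shows "(\<Sum>v\<in>verts G. gain v) \<le> rk G"
proof -
  \<comment> \<open>Segments are cut by label, not by size; where a label is missing, the segment
    does not change.\<close>
  let ?V = "\<lambda>n. {u \<in> verts G. h u < n}"
  have fin: "finite (verts G)" using G by (rule finite_verts)
  have step: "(\<Sum>v\<in>?V n. gain v) \<le> rk (induced G (?V n))" for n
  proof (induction n)
    case (Suc n)
    show ?case
    proof (cases "\<exists>v\<in>verts G. h v = n")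
      case True
      then obtain v where v: "v \<in> verts G" "h v = n" by blast
      have V: "?V (Suc n) = insert v (?V n)"
        using v inj_onD[OF h] by (auto simp: less_Suc_eq)
      have "(\<Sum>v\<in>?V (Suc n). gain v) = gain v + (\<Sum>v\<in>?V n. gain v)"
        unfolding V using fin v by simp
      also have "\<dots> \<le> rk (induced G (?V n)) + gain v" using Suc by simp
      also have "\<dots> \<le> rk (induced G (?V (Suc n)))"
        using gain[OF v(1)] v(2) unfolding V by (subst induced_insert[OF G]) auto
      finally show ?thesis .
    next
      case False
      then have "?V (Suc n) = ?V n" by (auto simp: less_Suc_eq)
      then show ?thesis using Suc by simp
    qed
  qed simp
  obtain n where "\<forall>x\<in>h ` verts G. x < n"
    using fin by (metis finite_imageI finite_nat_set_iff_bounded)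
  then have "?V n = verts G" by auto
  moreover have "induced G (verts G) = G" by (auto simp: induced_def verts_def)
  ultimately show ?thesis using step[of n] by simp
qed

text \<open>The first summand makes fewer than \<open>m\<close> earlier neighbours improbable, the
  second lets a surplus of \<open>1/4\<close> per vertex outweigh the \<open>2 ^ m\<close> of
  \<open>rk_complete_le\<close>, and the last ensures the \<open>2 \<le> c\<close> of
  \<open>k_connected_delete_simplicial\<close>.\<close>

definition threshold :: nat where
  "threshold = 12 * (D + 1) * m + 4 * 2 ^ m + 2"

lemma m_le_threshold: "m \<le> threshold"
proof -
  have "m \<le> 12 * (D + 1) * m" by simp
  then show ?thesis unfolding threshold_def by linarith
qed

text \<open>With probability \<open>1/3\<close> both \<open>u\<close> and \<open>w\<close> precede
  \<open>v\<close>, which earns \<open>1\<close>. Fewer than \<open>m\<close> elements of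
  \<open>N\<close> precede \<open>v\<close> with probability at most
  \<open>1 / (12 * (D + 1))\<close>, which costs \<open>D + 1\<close>. The mean gain is thus at
  least \<open>D + 1/3 - 1/12 = D + 1/4\<close>; the claim is this, multiplied by
  \<open>4 * card {p. p permutes V}\<close>.\<close>

lemma average_gain:
  fixes h :: "'a \<Rightarrow> nat"
  assumes "finite V" "inj_on h V" "v \<in> V" "N \<subseteq> V" "v \<notin> N" "u \<in> N" "w \<in> N" "u \<noteq> w"
    and deg: "12 * (D + 1) * m \<le> card N"
    and gain: "\<And>p. p permutes V \<Longrightarrow>
      D + (if position (h \<circ> p) {u, v, w} v = 2 then 1 else 0) \<le>
      gain p + (if position (h \<circ> p) (insert v N) v < m then D + 1 else 0)"
  shows "card {p. p permutes V} * (4 * D + 1) \<le> 4 * (\<Sum>p\<in>{p. p permutes V}. gain p)"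
proof -
  let ?P = "{p. p permutes V}"
  let ?good = "{p. p permutes V \<and> position (h \<circ> p) {u, v, w} v = 2}"
  let ?bad = "{p. p permutes V \<and> position (h \<circ> p) (insert v N) v < m}"
  have finP: "finite ?P" using assms(1) by (rule finite_permutations)
  have "u \<noteq> v" "w \<noteq> v" using assms(5-7) by auto
  then have "card {u, v, w} = 3" using assms(8) by (simp add: card_insert_if)
  moreover have "card {u, v, w} * card ?good = card ?P * card {j. j < card {u, v, w} \<and> j = 2}"
    using assms by (intro position_uniform[of V h "{u, v, w}" v "\<lambda>j. j = 2"]) auto
  moreover have "{j. j < (3::nat) \<and> j = 2} = {2}" by auto
  ultimately have good: "3 * card ?good = card ?P" by simp
  have "card (insert v N) * card ?bad = card ?P * card {j. j < card (insert v N) \<and> j < m}"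
    using assms by (intro position_uniform) auto
  also have "card {j. j < card (insert v N) \<and> j < m} \<le> card {..<m}" by (intro card_mono) auto
  finally have "card (insert v N) * card ?bad \<le> card ?P * m" by simp
  moreover have "12 * (D + 1) * m \<le> card (insert v N)"
    using deg assms finite_subset[of N V] by (simp add: le_SucI)
  ultimately have "12 * (D + 1) * m * card ?bad \<le> card ?P * m"
    by (meson mult_le_mono1 order_trans)
  then have "m * (12 * ((D + 1) * card ?bad)) \<le> m * card ?P" by (simp only: mult_ac)
  then have bad: "12 * ((D + 1) * card ?bad) \<le> card ?P" using m_pos by simp
  have "(\<Sum>p\<in>?P. D + (if position (h \<circ> p) {u, v, w} v = 2 then 1 else 0)) \<le>
      (\<Sum>p\<in>?P. gain p + (if position (h \<circ> p) (insert v N) v < m then D + 1 else 0))"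
    using gain by (intro sum_mono) auto
  then have "card ?P * D + card ?good \<le> (\<Sum>p\<in>?P. gain p) + card ?bad * (D + 1)"
    using finP by (simp add: sum.distrib sum.If_cases Int_def)
  then have "12 * (card ?P * D) + 12 * card ?good \<le>
      12 * (\<Sum>p\<in>?P. gain p) + 12 * ((D + 1) * card ?bad)"
    by (simp add: algebra_simps)
  then have "12 * (card ?P * D) + 3 * card ?P \<le> 12 * (\<Sum>p\<in>?P. gain p)"
    using good bad by linarith
  then show ?thesis by (simp add: algebra_simps)
qed

text \<open>If the unspanned pair \<open>u\<close>, \<open>w\<close> precedes \<open>v\<close>,
  \<open>star_ext_nonclique\<close> yields \<open>D + 1\<close>, and otherwise
  \<open>star_ext\<close> yields \<open>D\<close>; with fewer than \<open>m\<close> earlier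
  neighbours only monotonicity is used. The second part expresses the gain by positions, as
  \<open>average_gain\<close> expects.\<close>

lemma position_gain:
  fixes h :: "'a \<Rightarrow> nat"
  assumes "is_graph G" "v \<in> verts G" "u \<in> nbrs G v" "w \<in> nbrs G v" "u \<noteq> w"
    and nonedge: "rk G < rk (insert {u, w} G)"
  defines "E \<equiv> {x \<in> verts G. h x < h v}"
  defines "gain \<equiv> if card (nbrs G v \<inter> E) < m then 0 else if u \<in> E \<and> w \<in> E then D + 1 else D"
  shows "rk (induced G E) + gain \<le> rk (induced G E \<union> star v (nbrs G v \<inter> E))" (is ?thesis1)
    and "D + (if position h {u, v, w} v = 2 then 1 else 0) \<le>
      gain + (if position h (insert v (nbrs G v)) v < m then D + 1 else 0)" (is ?thesis2)
proof -
  let ?F = "induced G E" and ?S = "nbrs G v \<inter> E"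
  have gF: "is_graph ?F" using assms(1) by (rule graph_subset) (auto simp: induced_def)
  have vF: "v \<notin> verts ?F" using verts_induced[of G E] by (auto simp: E_def)
  have S: "finite ?S" "v \<notin> ?S"
    using finite_verts[OF assms(1)] by (auto simp: E_def)
  have finG: "finite G" using assms(1) by (rule graph_finite)
  have uv: "u \<noteq> v" "w \<noteq> v" using assms(3,4) not_in_nbrs[OF assms(1)] by auto
  show ?thesis1
  proof (cases "card ?S < m")
    case True
    then show ?thesis
      using finG S by (auto simp: gain_def induced_def star_def intro!: rk_mono)
  next
    case False
    show ?thesis
    proof (cases "u \<in> E \<and> w \<in> E")
      case True
      \<comment> \<open>An edge spanned by the induced subgraph would be spanned by
        \<open>G\<close>.\<close>
      have "rk ?F < rk (insert {u, w} ?F)"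
      proof (rule ccontr)
        assume "\<not> rk ?F < rk (insert {u, w} ?F)"
        then have "rk (G \<union> {{u, w}}) = rk G"
          using finG by (intro rk_closed_mono[of G _ ?F]) (auto simp: induced_def)
        then show False using nonedge by simp
      qed
      moreover have "{u, w} \<in> complete_graph ?S" using True assms by (simp add: complete_graph_iff)
      ultimately have "rk ?F + D + 1 \<le> rk (?F \<union> star v ?S)"
        using gF vF S False by (intro star_ext_nonclique) auto
      then show ?thesis using False True by (simp add: gain_def)
    next
      case nt: False
      have "rk ?F + D \<le> rk (?F \<union> star v ?S)"
        using gF vF S False D_le_m by (intro star_ext) auto
      then show ?thesis using False nt by (auto simp: gain_def)
    qed
  qed
  have "{y \<in> insert v (nbrs G v). h y < h v} = ?S"
    using nbrs_subset_verts[of G v] by (auto simp: E_def)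
  then have pos: "position h (insert v (nbrs G v)) v = card ?S" by (simp add: position_def)
  have "u \<in> E \<and> w \<in> E" if "position h {u, v, w} v = 2"
  proof -
    have "{y \<in> {u, v, w}. h y < h v} \<subseteq> {u, w}" by auto
    moreover have "card {u, w} = 2" using assms by simp
    ultimately have "{y \<in> {u, v, w}. h y < h v} = {u, w}"
      using that unfolding position_def by (intro card_seteq) auto
    then have "h u < h v" "h w < h v" by blast+
    then show ?thesis using assms nbrs_subset_verts[of G v] by (auto simp: E_def)
  qed
  then show ?thesis2 unfolding gain_def pos by auto
qed

text \<open>Otherwise each vertex has two nonadjacent neighbours and gains at least
  \<open>D + 1/4\<close> on average over all orderings. Then \<open>rk G\<close> is at least
  \<open>(D + 1/4) * card (verts G)\<close>, contrary to the bound
  \<open>D * card (verts G) + 2 ^ m\<close> for the complete graph.\<close>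

lemma ex_simplicial:
  assumes G: "is_graph G" and n: "threshold < card (verts G)"
    and deg: "\<And>v. v \<in> verts G \<Longrightarrow> threshold \<le> card (nbrs G v)"
    and closed: "\<And>u w. u \<in> verts G \<Longrightarrow> w \<in> verts G \<Longrightarrow> u \<noteq> w \<Longrightarrow> {u, w} \<notin> G \<Longrightarrow>
      rk G < rk (insert {u, w} G)"
  obtains v where "v \<in> verts G"
    "\<And>u w. u \<in> nbrs G v \<Longrightarrow> w \<in> nbrs G v \<Longrightarrow> u \<noteq> w \<Longrightarrow> {u, w} \<in> G"
proof (rule ccontr)
  assume no: "\<not> thesis"
  let ?V = "verts G"
  let ?P = "{p. p permutes ?V}"
  have fin: "finite ?V" using G by (rule finite_verts)
  have "\<forall>v\<in>?V. \<exists>u w. u \<in> nbrs G v \<and> w \<in> nbrs G v \<and> u \<noteq> w \<and> {u, w} \<notin> G"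
    using no that by blast
  then obtain a b where ab: "\<And>v. v \<in> ?V \<Longrightarrow> a v \<in> nbrs G v \<and> b v \<in> nbrs G v \<and> a v \<noteq> b v \<and> {a v, b v} \<notin> G"
    by metis
  have nonedge: "rk G < rk (insert {a v, b v} G)" if "v \<in> ?V" for v
    using ab[OF that] nbrs_subset_verts[of G v] by (intro closed) auto
  \<comment> \<open>Any injective labelling serves; the random ordering is
    \<open>h \<circ> p\<close>.\<close>
  obtain h :: "'a \<Rightarrow> nat" where h: "inj_on h ?V"
    using fin by (metis finite_imp_inj_to_nat_seg)
  define E where "E p v = {x \<in> ?V. (h \<circ> p) x < (h \<circ> p) v}" for p v
  define gain where "gain p v = (if card (nbrs G v \<inter> E p v) < m then 0
    else if a v \<in> E p v \<and> b v \<in> E p v then D + 1 else D)" for p v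
  have total: "(\<Sum>v\<in>?V. gain p v) \<le> rk G" if p: "p permutes ?V" for p
  proof (rule sum_gain_le_rk[OF G, of "h \<circ> p"])
    show "inj_on (h \<circ> p) ?V"
      using h p by (intro comp_inj_on permutes_inj_on) (auto simp: permutes_image)
    show "rk (induced G {u \<in> ?V. (h \<circ> p) u < (h \<circ> p) v}) + gain p v \<le>
      rk (induced G {u \<in> ?V. (h \<circ> p) u < (h \<circ> p) v} \<union> star v (nbrs G v \<inter> {u \<in> ?V. (h \<circ> p) u < (h \<circ> p) v}))"
      if "v \<in> ?V" for v
      using position_gain(1)[OF G that _ _ _ nonedge[OF that], of "h \<circ> p"] ab[OF that]
      unfolding gain_def E_def by blast
  qed
  have avg: "card ?P * (4 * D + 1) \<le> 4 * (\<Sum>p\<in>?P. gain p v)" if v: "v \<in> ?V" for v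
  proof (rule average_gain[OF fin h v nbrs_subset_verts[of G v], where u = "a v" and w = "b v"])
    show "v \<notin> nbrs G v" using G by (rule not_in_nbrs)
    show "12 * (D + 1) * m \<le> card (nbrs G v)" using deg[OF v] by (simp add: threshold_def)
    show "D + (if position (h \<circ> p) {a v, v, b v} v = 2 then 1 else 0) \<le>
        gain p v + (if position (h \<circ> p) (insert v (nbrs G v)) v < m then D + 1 else 0)" for p
      using position_gain(2)[OF G v _ _ _ nonedge[OF v], of "h \<circ> p"] ab[OF v]
      unfolding gain_def E_def by blast
  qed (use ab[OF v] in auto)
  \<comment> \<open>The total gain is estimated from below vertex by vertex and from above, by
    \<open>rk G\<close>, ordering by ordering.\<close>
  have "card ?V * (card ?P * (4 * D + 1)) = (\<Sum>v\<in>?V. card ?P * (4 * D + 1))" by simp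
  also have "\<dots> \<le> (\<Sum>v\<in>?V. 4 * (\<Sum>p\<in>?P. gain p v))" using avg by (rule sum_mono)
  also have "\<dots> = 4 * (\<Sum>p\<in>?P. \<Sum>v\<in>?V. gain p v)"
    by (subst sum.swap) (simp add: sum_distrib_left)
  also have "\<dots> \<le> 4 * (\<Sum>p\<in>?P. rk G)"
    using total by (intro mult_le_mono2 sum_mono) auto
  also have "\<dots> = card ?P * (4 * rk G)" by simp
  finally have "card ?P * (card ?V * (4 * D + 1)) \<le> card ?P * (4 * rk G)" by (simp only: mult_ac)
  moreover have "0 < card ?P"
    using finite_permutations[OF fin] by (auto simp: card_gt_0_iff intro: permutes_id)
  ultimately have "card ?V * (4 * D + 1) \<le> 4 * rk G" by simp
  moreover have "rk G \<le> rk (complete_graph ?V)"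
    using G fin by (intro rk_mono graph_finite complete_graph_graph graph_subset_complete) auto
  moreover have m: "m \<le> card ?V" "4 * 2 ^ m < card ?V"
    using n m_le_threshold by (auto simp: threshold_def)
  moreover have "rk (complete_graph ?V) \<le> D * card ?V + 2 ^ m" using fin m(1) by (rule rk_complete_le)
  moreover have "card ?V * (4 * D + 1) = 4 * (D * card ?V) + card ?V" by (simp add: algebra_simps)
  ultimately show False by linarith
qed

section \<open>Rigidity of highly connected graphs\<close>

text \<open>Passing to a closed supergraph \<open>H\<close> on the same vertices produces a
  simplicial vertex \<open>v\<close>. Deleting \<open>v\<close> keeps the connectivity, so the
  induction hypothesis applies; putting \<open>v\<close> back adds at least \<open>D\<close>, and
  the complete graph gains at most \<open>D\<close>.\<close>

theorem rk_highly_connected: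
  assumes "is_graph G" "k_connected threshold G"
  shows "rk G = rk (complete_graph (verts G))"
  using assms
proof (induction "card (verts G)" arbitrary: G rule: less_induct)
  case less
  let ?V = "verts G"
  have fin: "finite ?V" using less.prems(1) by (rule finite_verts)
  let ?K = "complete_graph ?V"
  have K: "is_graph ?K" "finite ?K" using fin complete_graph_graph graph_finite by blast+
  have GK: "G \<subseteq> ?K" using less.prems(1) by (rule graph_subset_complete) simp
  \<comment> \<open>A largest good \<open>H\<close> is the closure of \<open>G\<close> within
    \<open>?K\<close>, obtained by maximality.\<close>
  define good where "good H \<longleftrightarrow> G \<subseteq> H \<and> H \<subseteq> ?K \<and> rk H = rk G" for H
  have "good G" using GK by (simp add: good_def)
  moreover have "\<forall>H. good H \<longrightarrow> card H < Suc (card ?K)"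
    using K card_mono by (auto simp: good_def less_Suc_eq_le)
  ultimately obtain H where H: "good H" and H_max: "\<forall>H'. good H' \<longrightarrow> card H' \<le> card H"
    using ex_has_greatest_nat[of good G card "Suc (card ?K)"] by blast
  have gH: "is_graph H" using K(1) H by (auto simp: good_def intro: graph_subset)
  have vH: "verts H = ?V"
    using H verts_mono[of G H] verts_mono[of H ?K] verts_complete_subset[of ?V] by (auto simp: good_def)
  have cH: "k_connected threshold H"
    using less.prems(2) H vH by (auto simp: good_def intro: k_connected_superset)
  have finH: "finite H" using gH by (rule graph_finite)
  have closed: "rk H < rk (insert {u, w} H)" if "u \<in> ?V" "w \<in> ?V" "u \<noteq> w" "{u, w} \<notin> H" for u w
  proof (rule ccontr)
    assume "\<not> rk H < rk (insert {u, w} H)"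
    moreover have "rk H \<le> rk (insert {u, w} H)" using finH by (intro rk_mono) auto
    ultimately have "good (insert {u, w} H)"
      using H that by (auto simp: good_def complete_graph_iff)
    then show False using H_max finH that(4) by force
  qed
  have deg: "threshold \<le> card (nbrs H v)" if "v \<in> ?V" for v
    using k_connected_degree[OF gH cH] that vH by simp
  have n: "threshold < card ?V" using less.prems(2) by (simp add: k_connected_iff)
  obtain v where v: "v \<in> verts H"
    and clique: "\<And>u w. u \<in> nbrs H v \<Longrightarrow> w \<in> nbrs H v \<Longrightarrow> u \<noteq> w \<Longrightarrow> {u, w} \<in> H"
    using ex_simplicial[OF gH, of thesis] n deg closed that unfolding vH by blast
  have "rk ?K \<le> rk H"
  proof (cases "Suc threshold < card ?V")
    case True
    let ?H = "induced H (?V - {v})"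
    have del: "verts ?H = ?V - {v}" "k_connected threshold ?H"
      using k_connected_delete_simplicial[OF gH cH _ _ v clique] True
      unfolding vH by (auto simp: threshold_def)
    have v': "v \<in> ?V" using v vH by simp
    have gH': "is_graph ?H" using gH by (rule graph_subset) (auto simp: induced_def)
    have "card (verts ?H) < card ?V" unfolding del(1) using fin v' by (intro psubset_card_mono) auto
    then have IH: "rk ?H = rk (complete_graph (?V - {v}))"
      using less.hyps[of ?H] gH' del by simp
    have nb: "nbrs H v \<subseteq> ?V - {v}" using nbrs_subset_verts[of H v] vH not_in_nbrs[OF gH] by auto
    have "H = induced H (insert v (?V - {v}))"
      using v' vH by (auto simp: induced_def verts_def)
    also have "\<dots> = ?H \<union> star v (nbrs H v)"
      using induced_insert[OF gH, of v "?V - {v}"] nb by (simp add: Int_absorb2)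
    finally have Heq: "H = ?H \<union> star v (nbrs H v)" .
    have "rk ?H + D \<le> rk (?H \<union> star v (nbrs H v))"
      using gH' del(1) not_in_nbrs[OF gH] finite_subset[OF nb] fin deg[OF v'] m_le_threshold D_le_m
      by (intro star_ext) auto
    moreover have "rk (complete_graph (insert v (?V - {v}))) \<le> rk (complete_graph (?V - {v})) + D"
      using fin v' True m_le_threshold by (intro slope_le) auto
    moreover have "insert v (?V - {v}) = ?V" using v' by auto
    ultimately show ?thesis using IH Heq by simp
  next
    \<comment> \<open>At most \<open>threshold + 1\<close> vertices: by its degree \<open>v\<close>
      is adjacent to all others, and as its neighbourhood is a clique, \<open>H\<close> is
      complete.\<close>
    case False
    have v': "v \<in> ?V" using v vH by simp
    have nb: "nbrs H v \<subseteq> ?V - {v}" using nbrs_subset_verts[of H v] vH not_in_nbrs[OF gH] by auto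
    have "card (?V - {v}) \<le> card (nbrs H v)" using False deg[OF v'] v' fin by simp
    then have nbV: "nbrs H v = ?V - {v}" using nb fin by (intro card_seteq) auto
    have "{u, w} \<in> H" if uw: "u \<in> ?V" "w \<in> ?V" "u \<noteq> w" for u w
    proof -
      consider "u = v" | "w = v" | "u \<in> nbrs H v" "w \<in> nbrs H v" using uw(1,2) unfolding nbV by blast
      then show ?thesis
      proof cases
        case 1
        then have "w \<in> nbrs H v" using uw unfolding nbV by blast
        then show ?thesis using 1 by (simp add: nbrs_def)
      next
        case 2
        then have "u \<in> nbrs H v" using uw unfolding nbV by blast
        then show ?thesis using 2 by (simp add: nbrs_def insert_commute)
      next
        case 3
        then show ?thesis using clique uw(3) by blast
      qed
    qed
    then have "?K \<subseteq> H" by (auto simp: complete_graph_def)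
    then show ?thesis using finH by (intro rk_mono)
  qed
  moreover have "rk G \<le> rk ?K" using K GK by (intro rk_mono)
  ultimately show ?case using H by (simp add: good_def)
qed

end

section \<open>Packing connected graphs into complete bipartite graphs\<close>

lemma k_connected_antimono: "k_connected c G \<Longrightarrow> c' \<le> c \<Longrightarrow> k_connected c' G"
  by (simp add: k_connected_iff)

text \<open>An enumeration of \<open>S\<close> is classified by residues modulo \<open>n\<close>;
  below \<open>n * p\<close> every residue occurs \<open>p\<close> times.\<close>

lemma ex_large_classes:
  assumes "finite S" "n * p \<le> card S" "0 < n"
  obtains f :: "'a \<Rightarrow> nat" where "\<And>s. s \<in> S \<Longrightarrow> f s < n"
    "\<And>l. l < n \<Longrightarrow> p \<le> card {s \<in> S. f s = l}"
proof -
  obtain h where h: "bij_betw h S {0..<card S}" using ex_bij_betw_finite_nat[OF assms(1)] by blast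
  have "p \<le> card {s \<in> S. h s mod n = l}" if l: "l < n" for l
  proof -
    have "(\<lambda>q. q * n + l) ` {..<p} \<subseteq> h ` {s \<in> S. h s mod n = l}"
    proof
      fix j assume "j \<in> (\<lambda>q. q * n + l) ` {..<p}"
      then obtain q where q: "q < p" "j = q * n + l" by auto
      have "j < Suc q * n" using q l by simp
      also have "\<dots> \<le> p * n" using q(1) by (intro mult_le_mono1) simp
      also have "\<dots> \<le> card S" using assms(2) by (simp add: mult.commute)
      finally have "j \<in> h ` S" using h by (auto simp: bij_betw_def)
      moreover have "j mod n = l" using q(2) l by simp
      ultimately show "j \<in> h ` {s \<in> S. h s mod n = l}" by auto
    qed
    then have "card ((\<lambda>q. q * n + l) ` {..<p}) \<le> card {s \<in> S. h s mod n = l}"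
      using assms(1) by (intro surj_card_le) auto
    moreover have "card ((\<lambda>q. q * n + l) ` {..<p}) = p"
      using assms(3) by (subst card_image) (auto simp: inj_on_def)
    ultimately show ?thesis by simp
  qed
  then show thesis using that[of "\<lambda>s. h s mod n"] assms(3) by simp
qed

text \<open>Split each of \<open>S\<close> and \<open>T\<close> into \<open>2 * k\<close> large classes and write the class number as
  \<open>2 * i + b\<close>. An edge gets the index \<open>i\<close> of its end in \<open>T\<close> if the bits \<open>b\<close> of its ends agree,
  and the index of its end in \<open>S\<close> otherwise. In colour \<open>i\<close>, the classes with index \<open>i\<close> are
  completely joined, and every vertex is joined to one of them completely.\<close>

lemma bipartite_packing:
  assumes fin: "finite S" "finite T" and disj: "S \<inter> T = {}"
    and large: "2 * k * Suc c \<le> card S" "2 * k * Suc c \<le> card T"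
  obtains Gs where "\<forall>i<k. is_graph (Gs i) \<and> Gs i \<subseteq> bipartite S T \<and> verts (Gs i) = S \<union> T \<and> k_connected c (Gs i)"
    "\<forall>i<k. \<forall>j<k. i \<noteq> j \<longrightarrow> Gs i \<inter> Gs j = {}"
proof (cases "k = 0")
  case True
  then show thesis using that[of "\<lambda>_. {}"] by simp
next
  case False
  obtain f where f: "\<And>l. l < 2 * k \<Longrightarrow> Suc c \<le> card {s \<in> S. f s = l}"
    using ex_large_classes[OF fin(1) large(1)] False by (metis mult_pos_pos neq0_conv zero_less_numeral)
  obtain g where g: "\<And>l. l < 2 * k \<Longrightarrow> Suc c \<le> card {t \<in> T. g t = l}"
    using ex_large_classes[OF fin(2) large(2)] False by (metis mult_pos_pos neq0_conv zero_less_numeral)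
  define col where "col s t = (if f s mod 2 = g t mod 2 then g t div 2 else f s div 2)" for s t
  define Gs where "Gs i = {{s, t} | s t. s \<in> S \<and> t \<in> T \<and> col s t = i}" for i
  have GsI: "{s, t} \<in> Gs i" if "s \<in> S" "t \<in> T" "col s t = i" for s t i
    using that unfolding Gs_def by blast
  have sub: "Gs i \<subseteq> bipartite S T" for i
    unfolding Gs_def using bipartite_iff[OF disj] by blast
  have graph: "is_graph (Gs i)" for i
    using bipartite_graph[OF fin disj] sub by (rule graph_subset)
  have edge1: "{s, t} \<in> Gs i" if "s \<in> S" "t \<in> T" "g t = 2 * i + f s mod 2" for s t i
    using that by (intro GsI) (auto simp: col_def)
  \<comment> \<open>The class with index \<open>i\<close> and the bit opposite to that of
    \<open>t\<close>: the bits disagree, so the index of the end in \<open>S\<close> counts.\<close>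
  have edge2: "{s, t} \<in> Gs i" if "s \<in> S" "t \<in> T" "f s = 2 * i + (1 - g t mod 2)" for s t i
  proof (intro GsI)
    have "g t mod 2 = 0 \<or> g t mod 2 = 1" by auto
    then show "col s t = i" using that by (auto simp: col_def)
  qed (use that in auto)
  have core: "{s, t} \<in> Gs i" if "s \<in> S" "t \<in> T" "f s div 2 = i" "g t div 2 = i" for s t i
    using that by (intro GsI) (auto simp: col_def)
  have pickS: "\<exists>s. s \<in> S \<and> s \<notin> X \<and> f s = l" if "l < 2 * k" "card X \<le> c" "finite X" for l X
    using f[OF that(1)] card_mono[OF that(3), of "{s \<in> S. f s = l}"] that(2) by force
  have pickT: "\<exists>t. t \<in> T \<and> t \<notin> X \<and> g t = l" if "l < 2 * k" "card X \<le> c" "finite X" for l X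
    using g[OF that(1)] card_mono[OF that(3), of "{t \<in> T. g t = l}"] that(2) by force
  have lt: "2 * i + b < 2 * k" if "i < k" "b < 2" for i b :: nat using that by simp
  have flip: "1 - b < (2 :: nat)" for b :: nat by linarith
  have verts: "verts (Gs i) = S \<union> T" if i: "i < k" for i
  proof
    show "verts (Gs i) \<subseteq> S \<union> T"
      using verts_mono[OF sub[of i]] verts_bipartite_subset[of S T] by (rule subset_trans)
    have "s \<in> verts (Gs i)" if s: "s \<in> S" for s
    proof -
      obtain t where "t \<in> T" "g t = 2 * i + f s mod 2"
        using pickT[OF lt[OF i, of "f s mod 2"], of "{}"] by auto
      then show ?thesis using edge1[OF s] unfolding verts_def by blast
    qed
    moreover have "t \<in> verts (Gs i)" if t: "t \<in> T" for t
    proof -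
      obtain s where "s \<in> S" "f s = 2 * i + (1 - g t mod 2)"
        using pickS[OF lt[OF i flip[of "g t mod 2"]], of "{}"] by auto
      then show ?thesis using edge2[OF _ t] unfolding verts_def by blast
    qed
    ultimately show "S \<union> T \<subseteq> verts (Gs i)" by blast
  qed
  have conn: "k_connected c (Gs i)" if i: "i < k" for i
  proof (rule k_connected_hub)
    have "Suc c \<le> card {s \<in> S. f s = 2 * i}" using f[of "2 * i"] i by simp
    also have "\<dots> \<le> card (verts (Gs i))" unfolding verts[OF i] using fin by (intro card_mono) auto
    finally show "c < card (verts (Gs i))" by simp
    fix X assume X: "card X < c" "X \<subseteq> verts (Gs i)"
    have finX: "finite X" using X(2) fin unfolding verts[OF i] by (simp add: finite_subset)
    \<comment> \<open>Each class is larger than the deleted set, so representatives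
      \<open>x b\<close> and \<open>y b\<close> of the four classes with index \<open>i\<close>
      survive; \<open>x 0\<close> is the hub.\<close>
    have "\<exists>s. s \<in> S \<and> s \<notin> X \<and> f s = 2 * i + b" if "b < 2" for b
      using pickS[OF lt[OF i that]] X(1) finX by simp
    then obtain x where x: "\<And>b. b < 2 \<Longrightarrow> x b \<in> S \<and> x b \<notin> X \<and> f (x b) = 2 * i + b" by metis
    have "\<exists>t. t \<in> T \<and> t \<notin> X \<and> g t = 2 * i + b" if "b < 2" for b
      using pickT[OF lt[OF i that]] X(1) finX by simp
    then obtain y where y: "\<And>b. b < 2 \<Longrightarrow> y b \<in> T \<and> y b \<notin> X \<and> g (y b) = 2 * i + b" by metis
    have st: "(s, t) \<in> reach_rel (Gs i) X" "(t, s) \<in> reach_rel (Gs i) X"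
      if "{s, t} \<in> Gs i" "s \<in> S" "t \<in> T" "s \<notin> X" "t \<notin> X" for s t
      using that disj by (auto simp: reach_rel_iff insert_commute)
    have yx: "(y b, x b') \<in> reach_rel (Gs i) X" "(x b', y b) \<in> reach_rel (Gs i) X"
      if "b < 2" "b' < 2" for b b'
      using core[of "x b'" "y b" i] x[OF that(2)] y[OF that(1)] that st[of "x b'" "y b"] by auto
    \<comment> \<open>From \<open>S\<close> the route to the hub is via \<open>y ?b\<close>; from
      \<open>T\<close> it is via \<open>x ?b\<close> and \<open>y 0\<close>.\<close>
    have "(z, x 0) \<in> (reach_rel (Gs i) X)\<^sup>*" if z: "z \<in> verts (Gs i) - X" for z
    proof (cases "z \<in> S")
      case True
      let ?b = "f z mod 2"
      have "(z, y ?b) \<in> reach_rel (Gs i) X"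
        using edge1[of z "y ?b" i] y[of ?b] True z by (intro st) auto
      moreover have "(y ?b, x 0) \<in> reach_rel (Gs i) X" by (intro yx) auto
      ultimately show ?thesis by (meson converse_rtrancl_into_rtrancl r_into_rtrancl)
    next
      case False
      then have zT: "z \<in> T" using z verts[OF i] by auto
      let ?b = "1 - g z mod 2"
      have "(z, x ?b) \<in> reach_rel (Gs i) X"
        using edge2[of "x ?b" z i] x[OF flip[of "g z mod 2"]] zT z by (intro st) auto
      moreover have "(x ?b, y 0) \<in> reach_rel (Gs i) X" "(y 0, x 0) \<in> reach_rel (Gs i) X"
        by (intro yx flip; simp)+
      ultimately show ?thesis by (meson converse_rtrancl_into_rtrancl r_into_rtrancl)
    qed
    then show "\<exists>h. \<forall>z\<in>verts (Gs i) - X. (z, h) \<in> (reach_rel (Gs i) X)\<^sup>*" by blast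
  qed
  have "Gs i \<inter> Gs j = {}" if "i \<noteq> j" for i j
    using that disj unfolding Gs_def by (auto simp: doubleton_eq_iff)
  then show thesis using graph sub verts conn by (intro that[of Gs]) auto
qed

section \<open>Unions of graph matroids\<close>

lemma ex_disjoint_subsets:
  fixes k :: nat
  assumes "finite S" "(\<Sum>i<k. d i) \<le> card S"
  shows "\<exists>Ss. (\<forall>i<k. Ss i \<subseteq> S \<and> card (Ss i) = d i) \<and>
    (\<forall>i<k. \<forall>j<k. i \<noteq> j \<longrightarrow> Ss i \<inter> Ss j = {})"
  using assms
proof (induction k arbitrary: S)
  case (Suc k)
  obtain A where A: "A \<subseteq> S" "card A = d k"
    using Suc.prems(2) obtain_subset_with_card_n[of "d k" S] by auto
  have "(\<Sum>i<k. d i) \<le> card (S - A)"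
    using Suc.prems A by (simp add: card_Diff_subset finite_subset)
  then obtain Ss where Ss: "\<forall>i<k. Ss i \<subseteq> S - A \<and> card (Ss i) = d i"
      "\<forall>i<k. \<forall>j<k. i \<noteq> j \<longrightarrow> Ss i \<inter> Ss j = {}"
    using Suc.IH[of "S - A"] Suc.prems by auto
  show ?case
  proof (intro exI[of _ "Ss(k := A)"] conjI allI impI)
    fix i assume "i < Suc k"
    then show "(Ss(k := A)) i \<subseteq> S" "card ((Ss(k := A)) i) = d i"
      using Ss(1) A by (auto simp: less_Suc_eq)
    fix j assume "j < Suc k" "i \<noteq> j"
    then show "(Ss(k := A)) i \<inter> (Ss(k := A)) j = {}"
      using \<open>i < Suc k\<close> Ss by (cases "i = k"; cases "j = k") (simp_all add: less_Suc_eq, blast+)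
  qed
qed simp

locale lovasz_yemini_sequence =
  fixes Is :: "nat \<Rightarrow> 'a graph \<Rightarrow> bool" and k :: nat and cs :: "nat \<Rightarrow> nat"
  assumes parts: "i < k \<Longrightarrow> lovasz_yemini_matroid (Is i) (cs i)"
    and infinite_univ: "infinite (UNIV :: 'a set)"
begin

lemma parts_graph_matroid: "i < k \<Longrightarrow> graph_matroid (Is i)"
  by (rule lovasz_yemini_matroid.axioms(1)[OF parts])

sublocale matroid_sequence Is k
  by (rule matroid_sequence.intro) (rule graph_matroid.axioms(1)[OF parts_graph_matroid])

sublocale union: graph_matroid "union_indep Is k"
proof
  fix X assume "union_indep Is k X"
  then obtain Xs where Xs: "\<forall>i<k. Is i (Xs i)" "X = (\<Union>i<k. Xs i)"
    unfolding union_indep_def by blast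
  have "is_graph (Xs i)" if "i < k" for i
    using graph_matroid.indep_graph[OF parts_graph_matroid[OF that]] Xs(1) that by blast
  then show "is_graph X" unfolding Xs(2) is_graph_def by auto
  fix f :: "'a \<Rightarrow> 'a" assume f: "inj_on f (verts X)"
  have part: "Is i (gimage f (Xs i))" if "i < k" for i
  proof (rule graph_matroid.indep_gimage[OF parts_graph_matroid[OF that]])
    show "Is i (Xs i)" using Xs(1) that by blast
    have "Xs i \<subseteq> X" using Xs(2) that by blast
    then show "inj_on f (verts (Xs i))" using inj_on_subset[OF f verts_mono] by blast
  qed
  have "gimage f X = (\<Union>i<k. gimage f (Xs i))" unfolding Xs(2) by blast
  then show "union_indep Is k (gimage f X)"
    unfolding union_indep_def using part by (intro exI[of _ "\<lambda>i. gimage f (Xs i)"]) simp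
qed

text \<open>\<open>bipartite_packing\<close> gives every member a spanning subgraph of its own,
  edge-disjoint from the others and connected enough to have full rank; the sum of the
  \<open>cs i\<close> serves as common connectivity.\<close>

lemma rk_union_bipartite:
  assumes "finite S" "finite T" "S \<inter> T = {}"
    and large: "2 * k * Suc (\<Sum>i<k. cs i) \<le> card S" "2 * k * Suc (\<Sum>i<k. cs i) \<le> card T"
  shows "(\<Sum>i<k. mrank (complete_graph (S \<union> T)) (Is i)) \<le> union.rk (bipartite S T)"
proof -
  obtain Gs where Gs: "\<forall>i<k. is_graph (Gs i) \<and> Gs i \<subseteq> bipartite S T \<and> verts (Gs i) = S \<union> T \<and>
      k_connected (\<Sum>i<k. cs i) (Gs i)"
    and disj: "\<forall>i<k. \<forall>j<k. i \<noteq> j \<longrightarrow> Gs i \<inter> Gs j = {}"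
    by (rule bipartite_packing[OF assms])
  have "mrank (complete_graph (S \<union> T)) (Is i) = mrank (Gs i) (Is i)" if i: "i < k" for i
  proof -
    have "cs i \<le> (\<Sum>i<k. cs i)" using i by (intro member_le_sum) auto
    then have "k_connected (cs i) (Gs i)" using Gs i k_connected_antimono by blast
    then show ?thesis
      using lovasz_yemini_matroid.rk_connected[OF parts[OF i], of "Gs i"] Gs i by simp
  qed
  then have "(\<Sum>i<k. mrank (complete_graph (S \<union> T)) (Is i)) = (\<Sum>i<k. mrank (Gs i) (Is i))"
    by simp
  also have "\<dots> \<le> union.rk (bipartite S T)"
    using graph_finite[OF bipartite_graph[OF assms(1-3)]] Gs disj by (intro rk_union_ge) auto
  finally show ?thesis .
qed

text \<open>A basis of \<open>F\<close> splits into colour classes, and \<open>S\<close> contains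
  disjoint pieces of sizes \<open>d i\<close>. Attaching \<open>v\<close> to the \<open>i\<close>-th
  class by the \<open>i\<close>-th piece adds at least \<open>d i\<close> in the \<open>i\<close>-th
  member, and the resulting graphs are edge-disjoint.\<close>

lemma union_star_ext:
  assumes ext: "\<And>i F v S. i < k \<Longrightarrow> is_graph F \<Longrightarrow> v \<notin> verts F \<Longrightarrow> finite S \<Longrightarrow> v \<notin> S \<Longrightarrow>
      d i \<le> card S \<Longrightarrow> mrank F (Is i) + d i \<le> mrank (F \<union> star v S) (Is i)"
    and F: "is_graph F" "v \<notin> verts F" and S: "finite S" "v \<notin> S" "(\<Sum>i<k. d i) \<le> card S"
  shows "union.rk F + (\<Sum>i<k. d i) \<le> union.rk (F \<union> star v S)"
proof -
  have finF: "finite F" using F(1) by (rule graph_finite)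
  obtain X where X: "X \<subseteq> F" "union_indep Is k X" "card X = union.rk F"
    using union.basis_exists[OF finF] by blast
  obtain f where f: "\<forall>x\<in>X. f x < k" "\<forall>i<k. Is i {x \<in> X. f x = i}"
    using X(2) unfolding union_indep_colouring by blast
  define Xs where "Xs i = {x \<in> X. f x = i}" for i
  obtain Ss where Ss_all: "\<forall>i<k. Ss i \<subseteq> S \<and> card (Ss i) = d i"
    and Ss_disj: "\<forall>i<k. \<forall>j<k. i \<noteq> j \<longrightarrow> Ss i \<inter> Ss j = {}"
    using ex_disjoint_subsets[OF S(1,3)] by (elim exE conjE)
  have Ss: "Ss i \<subseteq> S" "card (Ss i) = d i" if "i < k" for i using Ss_all that by auto
  have XsF: "Xs i \<subseteq> F" for i using X(1) by (auto simp: Xs_def)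
  have avoid: "e \<notin> F" if "e \<in> star v A" for e A
    using that F(2) by (auto simp: star_def verts_def)
  have part: "card (Xs i) + d i \<le> mrank (Xs i \<union> star v (Ss i)) (Is i)" if i: "i < k" for i
  proof -
    have "mrank (Xs i) (Is i) = card (Xs i)"
      using f(2) i by (intro finitary_matroid.rk_indep[OF matroids[OF i]]) (simp add: Xs_def)
    moreover have "mrank (Xs i) (Is i) + d i \<le> mrank (Xs i \<union> star v (Ss i)) (Is i)"
      using i F S Ss(1)[OF i] Ss(2)[OF i] verts_mono[OF XsF] finite_subset[OF Ss(1)[OF i]]
      by (intro ext graph_subset[OF F(1) XsF]) auto
    ultimately show ?thesis by simp
  qed
  have "card X = (\<Sum>i<k. card (Xs i))"
    unfolding Xs_def using finite_subset[OF X(1) finF] f(1) by (rule card_colour_classes)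
  then have "union.rk F + (\<Sum>i<k. d i) = (\<Sum>i<k. card (Xs i) + d i)"
    using X(3) by (simp add: sum.distrib)
  also have "\<dots> \<le> (\<Sum>i<k. mrank (Xs i \<union> star v (Ss i)) (Is i))"
    using part by (intro sum_mono) auto
  also have "\<dots> \<le> union.rk (F \<union> star v S)"
  proof (rule rk_union_ge)
    show "finite (F \<union> star v S)" using finF S by (simp add: star_def)
    show "Xs i \<union> star v (Ss i) \<subseteq> F \<union> star v S" if "i < k" for i
      using XsF star_mono[OF Ss(1)[OF that]] by blast
    show "(Xs i \<union> star v (Ss i)) \<inter> (Xs j \<union> star v (Ss j)) = {}" if ij: "i < k" "j < k" "i \<noteq> j" for i j
    proof -
      have "Xs i \<inter> Xs j = {}" using ij(3) by (auto simp: Xs_def)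
      moreover have "star v (Ss i) \<inter> star v (Ss j) = {}"
        using Ss_disj[rule_format, OF ij] by (auto simp: star_def doubleton_eq_iff)
      ultimately show ?thesis using XsF avoid by blast
    qed
  qed
  finally show ?thesis .
qed

text \<open>On large complete and complete bipartite graphs the rank of the union is squeezed to the
  sum of the members' ranks on the complete graph: \<open>rk_union_le\<close> bounds it from above,
  \<open>rk_union_bipartite\<close> from below. Hence the slopes add up.\<close>

lemma union_extendable: obtains D m where "extendable_matroid (union_indep Is k) D m"
proof -
  define is_slope where "is_slope i d n \<longleftrightarrow> (\<forall>V v. finite V \<longrightarrow> n \<le> card V \<longrightarrow> v \<notin> V \<longrightarrow>
      mrank (complete_graph (insert v V)) (Is i) = mrank (complete_graph V) (Is i) + d)" for i d n
  have "\<exists>d n. is_slope i d n" if i: "i < k" for i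
  proof -
    show ?thesis
      by (rule lovasz_yemini_matroid.slope_exists[OF parts[OF i]]) (auto simp: is_slope_def)
  qed
  then obtain d n where "\<And>i. i < k \<Longrightarrow> is_slope i (d i) (n i)" by metis
  then have slope: "mrank (complete_graph (insert v V)) (Is i) = mrank (complete_graph V) (Is i) + d i"
    if "i < k" "finite V" "n i \<le> card V" "v \<notin> V" for i V v
    using that unfolding is_slope_def by blast
  let ?q = "2 * k * Suc (\<Sum>i<k. cs i)"
  let ?D = "\<Sum>i<k. d i"
  \<comment> \<open>\<open>2 * ?q\<close> lets a set of size \<open>m\<close> be split into two
    sides of size at least \<open>?q\<close>, the sum of the \<open>n i\<close> reaches the range of
    every slope, and \<open>?D + 1\<close> gives \<open>D_le_m\<close> and
    \<open>m_pos\<close>.\<close>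
  define m where "m = 2 * ?q + (\<Sum>i<k. n i) + ?D + 1"
  have "extendable_matroid (union_indep Is k) ?D m"
  proof
    show "infinite (UNIV :: 'a set)" by (rule infinite_univ)
    show "?D \<le> m" "0 < m" by (simp_all add: m_def)
    show "union.rk F + ?D \<le> union.rk (F \<union> star v S)"
      if "is_graph F" "v \<notin> verts F" "finite S" "v \<notin> S" "?D \<le> card S" for F v S
    proof (rule union_star_ext[OF _ that])
      show "mrank F (Is i) + d i \<le> mrank (F \<union> star v S) (Is i)"
        if "i < k" "is_graph F" "v \<notin> verts F" "finite S" "v \<notin> S" "d i \<le> card S" for i F v S
        using slope[OF that(1)] that(2-6)
        by (rule lovasz_yemini_matroid.star_extension[OF parts[OF that(1)]])
    qed
    show "union.rk (bipartite S T) = union.rk (complete_graph (S \<union> T))"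
      if ST: "finite S" "finite T" "S \<inter> T = {}" "m \<le> card S" "m \<le> card T" for S T
    proof (rule antisym)
      have fin: "finite (complete_graph (S \<union> T))"
        using ST by (intro graph_finite complete_graph_graph) simp
      show "union.rk (bipartite S T) \<le> union.rk (complete_graph (S \<union> T))"
        using ST fin by (intro union.rk_mono graph_subset_complete bipartite_graph verts_bipartite_subset)
      have "union.rk (complete_graph (S \<union> T)) \<le> (\<Sum>i<k. mrank (complete_graph (S \<union> T)) (Is i))"
        using fin by (rule rk_union_le)
      also have "\<dots> \<le> union.rk (bipartite S T)"
        using ST by (intro rk_union_bipartite) (auto simp: m_def)
      finally show "union.rk (complete_graph (S \<union> T)) \<le> union.rk (bipartite S T)" .
    qed
    show "union.rk (complete_graph (insert v V)) \<le> union.rk (complete_graph V) + ?D"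
      if V: "finite V" "m \<le> card V" "v \<notin> V" for V v
    proof -
      \<comment> \<open>On \<open>V\<close>, the union attains the sum of the members' ranks already
        on the complete bipartite graph with sides \<open>S\<close> and
        \<open>V - S\<close>.\<close>
      have "?q \<le> card V" using V(2) by (simp add: m_def)
      then obtain S where S: "S \<subseteq> V" "card S = ?q" using obtain_subset_with_card_n by metis
      have finS: "finite S" using S V finite_subset by blast
      let ?T = "V - S"
      have T: "?q \<le> card ?T" using S V finS by (simp add: m_def card_Diff_subset)
      have ST: "S \<union> ?T = V" using S by auto
      have ni: "n i \<le> card V" if "i < k" for i
      proof -
        have "n i \<le> (\<Sum>i<k. n i)" using that by (intro member_le_sum) auto
        then show ?thesis using V(2) by (simp add: m_def)
      qed
      have fin: "finite (complete_graph V)" "finite (complete_graph (insert v V))"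
        using V by (auto intro!: graph_finite complete_graph_graph)
      have "union.rk (complete_graph (insert v V)) \<le>
          (\<Sum>i<k. mrank (complete_graph (insert v V)) (Is i))"
        using fin(2) by (rule rk_union_le)
      also have "\<dots> = (\<Sum>i<k. mrank (complete_graph V) (Is i) + d i)"
        using slope ni V by (intro sum.cong) auto
      also have "\<dots> = (\<Sum>i<k. mrank (complete_graph V) (Is i)) + ?D" by (simp add: sum.distrib)
      also have "(\<Sum>i<k. mrank (complete_graph V) (Is i)) \<le> union.rk (bipartite S ?T)"
        using rk_union_bipartite[of S ?T] finS V(1) S(2) T unfolding ST by simp
      also have "union.rk (bipartite S ?T) \<le> union.rk (complete_graph V)"
        using finS V fin verts_bipartite_subset[of S ?T] unfolding ST
        by (intro union.rk_mono graph_subset_complete bipartite_graph) auto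
      finally show ?thesis by simp
    qed
  qed
  then show thesis by (rule that)
qed

end

section \<open>Graph matroid families\<close>

text \<open>\<open>X\<close> serves as its own ambient graph; by the restriction property this
  agrees with \<open>M G\<close> for every graph \<open>G\<close> containing \<open>X\<close>, as
  \<open>family_indep_iff\<close> shows.\<close>

definition family_indep :: "'a gmfam \<Rightarrow> 'a graph \<Rightarrow> bool" where
  "family_indep M X \<longleftrightarrow> is_graph X \<and> M X X"

lemma family_indep_iff:
  assumes "graph_matroid_family M" "is_graph G"
  shows "M G X \<longleftrightarrow> X \<subseteq> G \<and> family_indep M X"
proof -
  have sub: "X \<subseteq> G" if "M G X"
    using assms that unfolding graph_matroid_family_def matroid_def by blast
  have "M X X \<longleftrightarrow> M G X" if "X \<subseteq> G"
    using assms that unfolding graph_matroid_family_def by blast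
  then show ?thesis
    using sub graph_subset[OF assms(2)] unfolding family_indep_def by blast
qed

lemma graph_matroid_family_indep:
  assumes M: "graph_matroid_family M"
  shows "graph_matroid (family_indep M)"
proof
  have mat: "matroid G (M G)" if "is_graph G" for G
    using M that unfolding graph_matroid_family_def by blast
  show "is_graph X" if "family_indep M X" for X using that by (simp add: family_indep_def)
  show "finite X" if "family_indep M X" for X using that by (simp add: family_indep_def graph_finite)
  have "is_graph ({} :: 'a graph)" by (simp add: is_graph_def)
  then show "family_indep M {}" using mat[of "{}"] by (simp add: family_indep_def matroid_def)
  show "family_indep M Y" if "family_indep M X" "Y \<subseteq> X" for X Y
  proof -
    have X: "is_graph X" "M X X" using that(1) by (auto simp: family_indep_def)
    then have "M X Y" using mat[OF X(1)] that(2) unfolding matroid_def by blast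
    then show ?thesis using family_indep_iff[OF M X(1)] by simp
  qed
  show "\<exists>y\<in>Y - X. family_indep M (insert y X)"
    if XY: "family_indep M X" "family_indep M Y" "card X < card Y" for X Y
  proof -
    \<comment> \<open>Augmentation takes place in the common ambient graph
      \<open>X \<union> Y\<close>.\<close>
    have g: "is_graph (X \<union> Y)" using XY by (auto simp: family_indep_def intro: graph_Un)
    note iff = family_indep_iff[OF M g]
    have "M (X \<union> Y) X" "M (X \<union> Y) Y" using XY by (auto simp: iff)
    then obtain y where "y \<in> Y - X" "M (X \<union> Y) (insert y X)"
      using mat[OF g] XY(3) unfolding matroid_def by blast
    then show ?thesis using iff by blast
  qed
  show "family_indep M (gimage f X)" if X: "family_indep M X" and f: "inj_on f (verts X)" for X f
  proof -
    have g: "is_graph X" "M X X" using X by (auto simp: family_indep_def)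
    have g': "is_graph (gimage f X)" using g(1) f by (rule gimage_graph)
    have "{u, v} \<in> X \<longleftrightarrow> {f u, f v} \<in> gimage f X" if "u \<in> verts X" "v \<in> verts X" for u v
    proof
      assume "{f u, f v} \<in> gimage f X"
      then obtain e where e: "e \<in> X" "f ` {u, v} = f ` e" by auto
      then have "{u, v} = e"
        using inj_on_image_eq_iff[OF f, of "{u, v}" e] that by (auto simp: verts_def)
      then show "{u, v} \<in> X" using e by simp
    qed (use image_iff in fastforce)
    then have "graph_iso f X (gimage f X)"
      unfolding graph_iso_def verts_gimage using f by (auto simp: bij_betw_def)
    then have "M X X \<longleftrightarrow> M (gimage f X) (gimage f X)"
      using M g(1) g' unfolding graph_matroid_family_def by blast
    then show ?thesis using g g' by (simp add: family_indep_def)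
  qed
qed

lemma mrank_family:
  assumes "graph_matroid_family M" "is_graph G"
  shows "mrank G (M G) = mrank G (family_indep M)"
  unfolding mrank_def family_indep_iff[OF assms] by (rule arg_cong[where f = "\<lambda>A. Max (card ` A)"]) auto

lemma mrank_union_family:
  assumes "\<forall>i<k. graph_matroid_family (Ms i)" "is_graph G"
  shows "mrank G (union_family Ms k G) = mrank G (union_indep (\<lambda>i. family_indep (Ms i)) k)"
proof -
  have "union_family Ms k G X \<longleftrightarrow> union_indep (\<lambda>i. family_indep (Ms i)) k X" if "X \<subseteq> G" for X
  proof -
    have "Ms i G (Xs i) \<longleftrightarrow> family_indep (Ms i) (Xs i)"
      if "i < k" "X = (\<Union>i<k. Xs i)" for Xs :: "nat \<Rightarrow> 'a graph" and i
      using family_indep_iff[of "Ms i" G "Xs i"] assms that \<open>X \<subseteq> G\<close> by blast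
    then show ?thesis unfolding union_family_def union_indep_def by blast
  qed
  then have "{X. X \<subseteq> G \<and> union_family Ms k G X} =
      {X. X \<subseteq> G \<and> union_indep (\<lambda>i. family_indep (Ms i)) k X}" by blast
  then show ?thesis unfolding mrank_def by simp
qed

theorem theorem3p18:
  fixes Ms :: "nat \<Rightarrow> 'a gmfam" and k :: nat
  assumes "\<forall>i<k. graph_matroid_family (Ms i)"
    and "\<forall>i<k. lovasz_yemini (Ms i)"
  shows "lovasz_yemini (union_family Ms k)"
proof (cases "finite (UNIV :: 'a set)")
  case True
  \<comment> \<open>No graph has more than \<open>card UNIV\<close> vertices, so this connectivity
    is never attained and the property holds vacuously.\<close>
  have "\<not> k_connected (card (UNIV :: 'a set)) G" for G :: "'a graph"
    using card_mono[OF True subset_UNIV, of "verts G"] by (simp add: k_connected_def)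
  then show ?thesis unfolding lovasz_yemini_def by blast
next
  case False
  let ?Is = "\<lambda>i. family_indep (Ms i)"
  obtain cs where cs: "\<And>i G. i < k \<Longrightarrow> is_graph G \<Longrightarrow> k_connected (cs i) G \<Longrightarrow> rigid (Ms i) G"
    using assms(2) unfolding lovasz_yemini_def by metis
  have K: "is_graph (complete_graph (verts G))" if "is_graph G" for G :: "'a graph"
    using that by (intro complete_graph_graph finite_verts)
  interpret lovasz_yemini_sequence ?Is k cs
  proof (rule lovasz_yemini_sequence.intro)
    fix i assume i: "i < k"
    then have fam: "graph_matroid_family (Ms i)" using assms(1) by blast
    show "lovasz_yemini_matroid (?Is i) (cs i)"
    proof (rule lovasz_yemini_matroid.intro)
      show "graph_matroid (?Is i)" using fam by (rule graph_matroid_family_indep)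
      show "lovasz_yemini_matroid_axioms (?Is i) (cs i)"
        using False cs[OF i] mrank_family[OF fam] K
        by (intro lovasz_yemini_matroid_axioms.intro) (auto simp: rigid_def)
    qed
  qed (rule False)
  obtain D m where "extendable_matroid (union_indep ?Is k) D m" by (rule union_extendable)
  then interpret ext: extendable_matroid "union_indep ?Is k" D m .
  have "rigid (union_family Ms k) G" if "is_graph G" "k_connected ext.threshold G" for G
    using ext.rk_highly_connected[OF that] that(1) K[OF that(1)]
    by (simp add: rigid_def mrank_union_family[OF assms(1)])
  then show ?thesis unfolding lovasz_yemini_def by blast
qed

end
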